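(* Let $n\geq 1$ be an integer and let $E$ be a nonempty compact semi-algebraic subset of $\mathbb{R}^n$. Then there exist an integer $N>n$ and an $N$-player binary game such that the projection of its set of Nash equilibrium payoffs (a subset of $\mathbb{R}^N$) on its first $n$ coordinates is equal to $E$.
   Context: A game is binary if it is a finite normal-form game in which each player has exactly two pure strategies; payoffs of pure strategy profiles are arbitrary real numbers. Nash equilibria are understood in mixed strategies, with payoffs extended to mixed strategy profiles by expectation. The set of Nash equilibrium payoffs of an $N$-player game is the set of vectors in $\mathbb{R}^N$ whose $i$-th coordinate is the (expected) payoff of player $i$, as the mixed profile ranges over all Nash equilibria. A subset of $\mathbb{R}^n$ is semi-algebraic if it may be obtained by finitely many unions and intersections of sets defined by a (real) polynomial equality or strict inequality. *)

theory Defs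
  imports "HOL-Analysis.Analysis" "HOL-Probability.Probability" "HOL-Library.Poly_Mapping"
begin

(* Real polynomials in the variables x_0, x_1, ...: monomials are finitely supported exponent
   vectors, polynomials are finitely supported families of coefficients.  The library provides
   the ring structure, but no notion of evaluation. *)
type_synonym real_mpoly = "(nat \<Rightarrow>\<^sub>0 nat) \<Rightarrow>\<^sub>0 real"

definition mpoly_in_vars :: "nat \<Rightarrow> real_mpoly \<Rightarrow> bool" where
  "mpoly_in_vars n p \<longleftrightarrow> (\<forall>m\<in>Poly_Mapping.keys p. Poly_Mapping.keys m \<subseteq> {..<n})"

definition mpoly_eval :: "real_mpoly \<Rightarrow> (nat \<Rightarrow> real) \<Rightarrow> real" where
  "mpoly_eval p x =
     (\<Sum>m\<in>Poly_Mapping.keys p.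
        Poly_Mapping.lookup p m *
        (\<Prod>i\<in>Poly_Mapping.keys m. x i ^ Poly_Mapping.lookup m i))"

(* R^n is the library's Euclidean_space n, whose points are the functions x :: nat => real
   with x i = 0 for all i >= n. *)
inductive semialgebraic :: "nat \<Rightarrow> (nat \<Rightarrow> real) set \<Rightarrow> bool" for n :: nat where
  eq: "mpoly_in_vars n p \<Longrightarrow>
         semialgebraic n {x \<in> topspace (Euclidean_space n). mpoly_eval p x = 0}"
| gt: "mpoly_in_vars n p \<Longrightarrow>
         semialgebraic n {x \<in> topspace (Euclidean_space n). mpoly_eval p x > 0}"
| Un: "semialgebraic n A \<Longrightarrow> semialgebraic n B \<Longrightarrow> semialgebraic n (A \<union> B)"
| Int: "semialgebraic n A \<Longrightarrow> semialgebraic n B \<Longrightarrow> semialgebraic n (A \<inter> B)"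

(* In an N-player game u the players are 0, ..., N - 1, each with the two pure strategies False
   and True; u i s is the payoff of player i at the pure profile s.  Only the values u i s with
   i < N and s in the extensional function space {..<N} \<rightarrow>\<^sub>E UNIV matter: Pi_pmf with
   default value undefined is the product distribution on that space. *)
type_synonym binary_game = "nat \<Rightarrow> (nat \<Rightarrow> bool) \<Rightarrow> real"

type_synonym mixed_profile = "nat \<Rightarrow> bool pmf"

definition expected_payoff :: "nat \<Rightarrow> binary_game \<Rightarrow> mixed_profile \<Rightarrow> nat \<Rightarrow> real" where
  "expected_payoff N u \<sigma> i = measure_pmf.expectation (Pi_pmf {..<N} undefined \<sigma>) (u i)"

definition nash_equilibrium :: "nat \<Rightarrow> binary_game \<Rightarrow> mixed_profile \<Rightarrow> bool" where
  "nash_equilibrium N u \<sigma> \<longleftrightarrow>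
     (\<forall>i<N. \<forall>\<tau>. expected_payoff N u (\<sigma>(i := \<tau>)) i \<le> expected_payoff N u \<sigma> i)"

definition nash_payoffs :: "nat \<Rightarrow> binary_game \<Rightarrow> (nat \<Rightarrow> real) set" where
  "nash_payoffs N u =
     {(\<lambda>i. if i < N then expected_payoff N u \<sigma> i else 0) | \<sigma>. nash_equilibrium N u \<sigma>}"

definition proj_first :: "nat \<Rightarrow> (nat \<Rightarrow> real) \<Rightarrow> (nat \<Rightarrow> real)" where
  "proj_first n x = (\<lambda>i. if i < n then x i else 0)"

end

theory Submission
  imports Defs "HOL-Computational_Algebra.Fundamental_Theorem_Algebra"
begin

text \<open>Quantifier elimination over the reals yields a Lojasiewicz inequality, by which a compact
  semialgebraic set is described by finite unions and intersections of conditions \<open>f \<ge> 0\<close>.  With slack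
  variables it becomes the projection of the zero set, within a cube, of one nonnegative polynomial
  \<open>\<Psi>\<close>.  The cube is the space of mixed strategies of some players, who are indifferent where
  \<open>\<Psi> = 0\<close> and otherwise are pulled towards a fixed zero of \<open>\<Psi>\<close>; auxiliary players copy
  probabilities, so that \<open>\<Psi>\<close> can be evaluated although expected payoffs are only multiaffine.\<close>

section \<open>Sign correspondences between real polynomials\<close>

text \<open>Incentives can enforce polynomial equations on the cube, hence only closed conditions. A
  strict inequality \<open>d > 0\<close> would need a slack \<open>z\<close> with
  \<open>z ^ 2 * d = 1\<close>, which is unbounded, and relaxing it to \<open>d \<ge> 0\<close> may
  enlarge the set. The Lojasiewicz inequality supplies the missing polynomials: for each sign vector
  occurring off \<open>E\<close>, finitely many that are all negative there, while every point of
  \<open>E\<close> makes at least one of them nonnegative. Elimination is accordingly phrased with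
  sign vectors of finite families of polynomials instead of formulas. In the game, the factor
  multiplying \<open>\<Psi>\<close> has to change sign at \<open>w\<close>: with
  \<open>\<Psi> > 0\<close>, a player on either side of \<open>w\<close> would be driven to the far
  end of the unit interval, past \<open>w\<close>, which is absurd. A player \<open>i < n\<close> is
  indifferent in every equilibrium, so its payoff is the part that it cannot influence; this part
  reads the player's own probability off a copy and rescales the unit interval to
  \<open>[-M, M]\<close>.\<close>

lemma poly_sgn_eq_no_root:
  fixes p :: "real poly"
  assumes "\<And>c. min a b \<le> c \<Longrightarrow> c \<le> max a b \<Longrightarrow> poly p c \<noteq> 0"
  shows "sgn (poly p a) = sgn (poly p b)"
proof (rule ccontr)
  assume neq: "sgn (poly p a) \<noteq> sgn (poly p b)"
  have "poly p a \<noteq> 0" "poly p b \<noteq> 0" using assms[of a] assms[of b] by auto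
  with neq have *: "poly p a * poly p b < 0" "poly p b * poly p a < 0"
    by (auto simp: sgn_if mult_less_0_iff split: if_splits)
  have "a \<noteq> b" using neq by auto
  then consider "a < b" | "b < a" by linarith
  then show False
  proof cases
    case 1
    from poly_IVT[OF 1 *(1)] assms show False by force
  next
    case 2
    from poly_IVT[OF 2 *(2)] assms show False by force
  qed
qed

text \<open>By the mean value theorem the sign is that of the derivative at an inner point, hence
  that at \<open>a\<close>. The end point \<open>b\<close> is exempt because it may be a root of the
  derivative.\<close>

lemma poly_sgn_diff:
  fixes p :: "real poly"
  assumes "\<And>c. (a \<le> c \<and> c < b) \<or> (b < c \<and> c \<le> a) \<Longrightarrow> poly (pderiv p) c \<noteq> 0"
  shows "sgn (poly p b - poly p a) = sgn (poly (pderiv p) a) * sgn (b - a)"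
proof -
  have sg: "sgn (poly (pderiv p) c) = sgn (poly (pderiv p) a)" if "(a < c \<and> c < b) \<or> (b < c \<and> c < a)" for c
    by (rule poly_sgn_eq_no_root) (use assms that in auto)
  consider "a = b" | "a < b" | "b < a" by linarith
  then show ?thesis
  proof cases
    case 2
    then obtain c where "a < c" "c < b" "poly p b - poly p a = (b - a) * poly (pderiv p) c"
      using poly_MVT by blast
    then show ?thesis using sg[of c] by (simp add: sgn_mult)
  next
    case 3
    then obtain c where c: "b < c" "c < a" "poly p a - poly p b = (a - b) * poly (pderiv p) c"
      using poly_MVT by blast
    then have "poly p b - poly p a = (b - a) * poly (pderiv p) c" by (simp add: algebra_simps)
    then show ?thesis using sg[of c] c by (simp add: sgn_mult)
  qed simp
qed

lemma poly_abs_unbounded: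
  fixes q :: "real poly"
  assumes "pderiv q \<noteq> 0"
  obtains r where "\<And>x. r \<le> \<bar>x\<bar> \<Longrightarrow> K \<le> \<bar>poly q x\<bar>"
proof -
  obtain a q' where q: "q = pCons a q'" by (cases q)
  have "q' \<noteq> 0" using assms q by (auto simp: pderiv_pCons)
  from poly_infinity[OF this, of K a] show thesis using that q by (auto simp: real_norm_def)
qed

text \<open>A correspondence between two copies of the real line that matches the signs of paired
  polynomials.  Order is only required to be preserved relative to roots, so that adding
  a polynomial to the family merely restricts a relation, with no gluing of homeomorphisms.\<close>

definition sign_corr :: "(real poly \<times> real poly) set \<Rightarrow> (real \<Rightarrow> real \<Rightarrow> bool) \<Rightarrow> bool" where
  "sign_corr W R \<longleftrightarrow> (\<forall>t. \<exists>t'. R t t') \<and> (\<forall>t'. \<exists>t. R t t') \<and>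
     (\<forall>P Q. (P, Q) \<in> W \<longrightarrow> (P = 0 \<longleftrightarrow> Q = 0)) \<and>
     (\<forall>P Q t t'. (P, Q) \<in> W \<longrightarrow> R t t' \<longrightarrow> sgn (poly P t) = sgn (poly Q t')) \<and>
     (\<forall>P Q z z' t t'. (P, Q) \<in> W \<longrightarrow> P \<noteq> 0 \<longrightarrow> poly P z = 0 \<longrightarrow> R z z' \<longrightarrow> R t t' \<longrightarrow>
        sgn (t - z) = sgn (t' - z'))"

lemma sign_corrI:
  assumes "\<And>t. \<exists>t'. R t t'" "\<And>t'. \<exists>t. R t t'"
    "\<And>P Q. (P, Q) \<in> W \<Longrightarrow> P = 0 \<longleftrightarrow> Q = 0"
    "\<And>P Q t t'. (P, Q) \<in> W \<Longrightarrow> R t t' \<Longrightarrow> sgn (poly P t) = sgn (poly Q t')"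
    "\<And>P Q z z' t t'. (P, Q) \<in> W \<Longrightarrow> P \<noteq> 0 \<Longrightarrow> poly P z = 0 \<Longrightarrow> R z z' \<Longrightarrow> R t t' \<Longrightarrow>
       sgn (t - z) = sgn (t' - z')"
  shows "sign_corr W R"
  unfolding sign_corr_def by (intro conjI allI impI) (fact assms)+

lemma sign_corrD:
  assumes "sign_corr W R"
  shows "\<exists>t'. R t t'" "\<exists>t. R t t'"
    "(P, Q) \<in> W \<Longrightarrow> P = 0 \<longleftrightarrow> Q = 0"
    "(P, Q) \<in> W \<Longrightarrow> R t t' \<Longrightarrow> sgn (poly P t) = sgn (poly Q t')"
    "(P, Q) \<in> W \<Longrightarrow> P \<noteq> 0 \<Longrightarrow> poly P z = 0 \<Longrightarrow> R z z' \<Longrightarrow> R t t' \<Longrightarrow> sgn (t - z) = sgn (t' - z')"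
proof -
  note * = assms[unfolded sign_corr_def]
  show "\<exists>t'. R t t'" using *[THEN conjunct1] by (rule spec)
  show "\<exists>t. R t t'" using *[THEN conjunct2, THEN conjunct1] by (rule spec)
  show "(P, Q) \<in> W \<Longrightarrow> P = 0 \<longleftrightarrow> Q = 0"
    using *[THEN conjunct2, THEN conjunct2, THEN conjunct1] by iprover
  show "(P, Q) \<in> W \<Longrightarrow> R t t' \<Longrightarrow> sgn (poly P t) = sgn (poly Q t')"
    using *[THEN conjunct2, THEN conjunct2, THEN conjunct2, THEN conjunct1] by iprover
  show "(P, Q) \<in> W \<Longrightarrow> P \<noteq> 0 \<Longrightarrow> poly P z = 0 \<Longrightarrow> R z z' \<Longrightarrow> R t t' \<Longrightarrow> sgn (t - z) = sgn (t' - z')"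
    using *[THEN conjunct2, THEN conjunct2, THEN conjunct2, THEN conjunct2] by iprover
qed

text \<open>Lets the extension step be proved in one direction only. The order clause speaks of
  roots of first components, but the sign clause matches a root of \<open>Q\<close> with a root of
  \<open>P\<close>.\<close>

lemma sign_corr_converse:
  assumes "sign_corr W R"
  shows "sign_corr (W\<inverse>) (\<lambda>x y. R y x)"
proof -
  have "sgn (t - z) = sgn (t' - z')"
    if "(P, Q) \<in> W" "Q \<noteq> 0" "poly Q z = 0" "R z' z" "R t' t" for P Q z z' t t'
  proof -
    have "P \<noteq> 0" using sign_corrD(3)[OF assms that(1)] that by blast
    moreover have "poly P z' = 0" using sign_corrD(4)[OF assms that(1) that(4)] that(3)
      by (simp add: sgn_eq_0_iff)
    ultimately show ?thesis using sign_corrD(5)[OF assms that(1) _ _ that(4,5)] by simp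
  qed
  note ord = this
  show ?thesis
  proof (rule sign_corrI)
    show "P = 0 \<longleftrightarrow> Q = 0" if "(P, Q) \<in> W\<inverse>" for P Q
      using sign_corrD(3)[OF assms, of Q P] that by auto
    show "sgn (poly P t) = sgn (poly Q t')" if "(P, Q) \<in> W\<inverse>" "R t' t" for P Q t t'
      using sign_corrD(4)[OF assms, of Q P t' t] that by auto
    show "sgn (t - z) = sgn (t' - z')"
      if "(P, Q) \<in> W\<inverse>" "P \<noteq> 0" "poly P z = 0" "R z' z" "R t' t" for P Q z z' t t'
      using ord[of Q P z z' t' t] that by simp
  qed (use sign_corrD(1,2)[OF assms] in auto)
qed

text \<open>The zero polynomial is excluded so that there are only finitely many such
  points.\<close>

abbreviation root_of :: "(real poly \<times> real poly) set \<Rightarrow> real \<Rightarrow> bool" where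
  "root_of W z \<equiv> \<exists>(P, Q)\<in>W. P \<noteq> 0 \<and> poly P z = 0"

text \<open>Between consecutive roots, \<open>t\<close> may be matched with any point between their
  partners. This freedom is what allows a further polynomial to be matched.\<close>

abbreviation same_pos :: "(real poly \<times> real poly) set \<Rightarrow> (real \<Rightarrow> real \<Rightarrow> bool) \<Rightarrow> real \<Rightarrow> real \<Rightarrow> bool" where
  "same_pos W R t t' \<equiv> \<forall>z z'. root_of W z \<and> R z z' \<longrightarrow> sgn (t - z) = sgn (t' - z')"

lemma sgn_real_cases: "sgn (x::real) = sgn y \<longleftrightarrow> (x > 0 \<longleftrightarrow> y > 0) \<and> (x < 0 \<longleftrightarrow> y < 0)"
  by (auto simp: sgn_if)

lemma finite_roots_of:
  assumes "finite W"
  shows "finite {z. root_of W z}"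
proof -
  have "{z. root_of W z} = (\<Union>(P, Q)\<in>{(P, Q)\<in>W. P \<noteq> 0}. {z. poly P z = 0})" by auto
  also have "finite \<dots>" using assms by (auto intro!: finite_UN_I poly_roots_finite elim: finite_subset[rotated])
  finally show ?thesis .
qed

lemma root_sgn_corr:
  assumes "sign_corr W R" "root_of W z" "R z z'" "R t t'"
  shows "sgn (t - z) = sgn (t' - z')"
  using assms(2) sign_corrD(5)[OF assms(1) _ _ _ assms(3,4)] by auto

text \<open>A root of \<open>Q\<close> at \<open>t'\<close> would be the partner of a root of
  \<open>P\<close>, and having the same position would make \<open>t\<close> equal to that
  root.\<close>

lemma same_pos_no_root:
  assumes c: "sign_corr W R" and "\<not> root_of W t" "same_pos W R t t'" "(P, Q) \<in> W" "Q \<noteq> 0"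
  shows "poly Q t' \<noteq> 0"
proof
  assume q: "poly Q t' = 0"
  obtain z where z: "R z t'" using sign_corrD(2)[OF c] by blast
  have "poly P z = 0" using sign_corrD(4)[OF c assms(4) z] q by (simp add: sgn_eq_0_iff)
  moreover have "P \<noteq> 0" using sign_corrD(3)[OF c assms(4)] assms(5) by blast
  ultimately have "root_of W z" using assms(4) by blast
  with assms(3) z have "sgn (t - z) = sgn (t' - t')" by blast
  then have "t = z" by (simp add: sgn_eq_0_iff)
  then show False using \<open>root_of W z\<close> assms(2) by simp
qed

text \<open>Off the roots, every root partner lies strictly to one side of the candidates, so these
  form an interval on which intermediate values can be used.\<close>

lemma same_pos_convex:
  assumes "\<not> root_of W t" "same_pos W R t a" "same_pos W R t b" "min a b \<le> c" "c \<le> max a b"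
  shows "same_pos W R t c"
proof (intro allI impI)
  fix z z' assume z: "root_of W z \<and> R z z'"
  have "sgn (t - z) = sgn (a - z')" "sgn (t - z) = sgn (b - z')" "t \<noteq> z"
    using assms(1-3) z by blast+
  then show "sgn (t - z) = sgn (c - z')" using assms(4,5) by (auto simp: sgn_real_cases)
qed

lemma same_pos_sgn:
  assumes c: "sign_corr W R" and nt: "\<not> root_of W t" "same_pos W R t a" "same_pos W R t b" "(P, Q) \<in> W"
  shows "sgn (poly Q a) = sgn (poly Q b)"
proof (cases "Q = 0")
  case False
  show ?thesis
  proof (rule poly_sgn_eq_no_root)
    fix c' assume "min a b \<le> c'" "c' \<le> max a b"
    from same_pos_convex[OF nt(1-3) this] show "poly Q c' \<noteq> 0"
      using same_pos_no_root[OF c nt(1) _ nt(4) False] by blast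
  qed
qed simp

lemma poly_locally_pos:
  fixes q :: "real poly"
  assumes "\<sigma> * poly q v > 0"
  obtains e where "e > 0" "\<And>x. \<bar>x - v\<bar> < e \<Longrightarrow> \<sigma> * poly q x > 0"
proof -
  have "isCont (\<lambda>x. \<sigma> * poly q x) v" by (intro continuous_intros)
  then have "\<forall>\<^sub>F x in at v. \<sigma> * poly q x > 0"
    using assms by (auto simp: isCont_def intro: order_tendstoD)
  then obtain e where "e > 0" "\<And>x. x \<noteq> v \<Longrightarrow> dist x v < e \<Longrightarrow> \<sigma> * poly q x > 0"
    unfolding eventually_at by auto
  then have "\<sigma> * poly q x > 0" if "\<bar>x - v\<bar> < e" for x
    using assms that by (cases "x = v") (auto simp: dist_real_def)
  then show thesis using that[of e] \<open>e > 0\<close> by blast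
qed

text \<open>The derivatives belong to the family, so \<open>p\<close> and \<open>q\<close> are
  monotone between neighbouring roots, and \<open>\<sigma> * p\<close> increases to the right of
  \<open>t\<close>. It is thus positive at the next root \<open>v\<close>, where
  \<open>agree\<close> carries the sign over to \<open>q\<close>; without a next root,
  \<open>q\<close> is unbounded on that side.\<close>

lemma sign_corr_reach_right:
  assumes c: "sign_corr W R" and fin: "finite W"
    and dpq: "(pderiv p, pderiv q) \<in> W" "pderiv p \<noteq> 0"
    and agree: "\<And>z z'. root_of W z \<Longrightarrow> R z z' \<Longrightarrow> sgn (poly p z) = sgn (poly q z')"
    and nt: "\<not> root_of W t" and t0: "R t t0"
    and s: "\<sigma> \<noteq> 0" "\<sigma> * poly p t \<ge> 0" and d: "\<sigma> * poly (pderiv p) t > 0"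
  obtains t' where "same_pos W R t t'" "\<sigma> * poly q t' > 0"
proof -
  have I0: "same_pos W R t t0" using root_sgn_corr[OF c _ _ t0] by blast
  have dq0: "pderiv q \<noteq> 0" using sign_corrD(3)[OF c dpq(1)] dpq(2) by simp
  show thesis
  proof (cases "\<exists>z. root_of W z \<and> t < z")
    case False
    have I: "same_pos W R t x" if "t0 \<le> x" for x
    proof (intro allI impI)
      fix z z' assume z: "root_of W z \<and> R z z'"
      have "t \<noteq> z" using nt z by blast
      moreover have "sgn (t - z) = sgn (t0 - z')" using I0 z by blast
      ultimately show "sgn (t - z) = sgn (x - z')" using that False z
        by (auto simp: sgn_real_cases not_less)
    qed
    have nr: "poly (pderiv q) x \<noteq> 0" if "t0 \<le> x" for x
      using same_pos_no_root[OF c nt I[OF that] dpq(1) dq0] .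
    obtain r where r: "\<And>x. r \<le> \<bar>x\<bar> \<Longrightarrow> \<bar>poly q t0\<bar> + 1 \<le> \<bar>poly q x\<bar>"
      using poly_abs_unbounded[OF dq0] by blast
    \<comment> \<open>So far to the right of \<open>t0\<close> that the absolute value of
      \<open>q\<close> exceeds that at \<open>t0\<close>; as \<open>\<sigma> * q\<close> has grown
      on the way, it must be positive here.\<close>
    define x where "x = \<bar>r\<bar> + \<bar>t0\<bar> + 1"
    have x: "t0 < x" "r \<le> \<bar>x\<bar>" by (auto simp: x_def)
    have "sgn (poly q x - poly q t0) = sgn (poly (pderiv q) t0) * sgn (x - t0)"
      by (rule poly_sgn_diff) (use nr x in auto)
    also have "sgn (poly (pderiv q) t0) = sgn (poly (pderiv p) t)"
      using sign_corrD(4)[OF c dpq(1) t0] by simp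
    finally have "sgn (poly q x - poly q t0) = sgn (poly (pderiv p) t)" using x by simp
    then have "\<sigma> * (poly q x - poly q t0) > 0" using d
      by (auto simp: zero_less_mult_iff sgn_real_cases)
    then have "\<sigma> * poly q x > 0" using r[OF x(2)] s
      by (cases "\<sigma> > 0") (auto simp: zero_less_mult_iff)
    then show thesis by (intro that[OF I[of x]]) (use x in auto)
  next
    case True
    define v where "v = Min {z. root_of W z \<and> t < z}"
    have fin': "finite {z. root_of W z \<and> t < z}" using finite_roots_of[OF fin] by (rule rev_finite_subset) auto
    have "v \<in> {z. root_of W z \<and> t < z}" unfolding v_def by (rule Min_in) (use fin' True in auto)
    then have v: "root_of W v" "t < v" by auto
    have vmin: "v \<le> z" if "root_of W z" "t < z" for z
      unfolding v_def by (rule Min_le) (use fin' that in auto)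
    obtain v' where v': "R v v'" using sign_corrD(1)[OF c] by blast
    have "sgn (t - v) = sgn (t0 - v')" using I0 v v' by blast
    then have tv': "t0 < v'" using v(2) unfolding sgn_real_cases by linarith
    have "sgn (poly p v - poly p t) = sgn (poly (pderiv p) t) * sgn (v - t)"
    proof (rule poly_sgn_diff)
      fix x assume "t \<le> x \<and> x < v \<or> v < x \<and> x \<le> t"
      then have x: "t \<le> x" "x < v" using v by auto
      then have "\<not> root_of W x" using vmin[of x] nt by (cases "t = x") force+
      then show "poly (pderiv p) x \<noteq> 0" using dpq by blast
    qed
    then have "\<sigma> * (poly p v - poly p t) > 0" using d v
      by (auto simp: zero_less_mult_iff sgn_real_cases)
    then have "\<sigma> * poly p v > 0" using s(2) by (simp add: algebra_simps)
    then have "\<sigma> * poly q v' > 0" using agree[OF v(1) v'] by (auto simp: zero_less_mult_iff sgn_real_cases)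
    then obtain e where e: "e > 0" "\<And>x. \<bar>x - v'\<bar> < e \<Longrightarrow> \<sigma> * poly q x > 0"
      using poly_locally_pos by blast
    \<comment> \<open>Close enough to \<open>v'\<close> for the sign of \<open>q\<close>, yet left
      of \<open>v'\<close> and not left of \<open>t0\<close>, so that the position relative to all
      root partners is kept.\<close>
    define x where "x = max t0 (v' - e / 2)"
    have x: "t0 \<le> x" "x < v'" "\<bar>x - v'\<bar> < e" using tv' e(1) by (auto simp: x_def max_def)
    have "same_pos W R t x"
    proof (intro allI impI)
      fix z z' assume z: "root_of W z \<and> R z z'"
      have "t \<noteq> z" using nt z by blast
      moreover have "sgn (t - z) = sgn (t0 - z')" using I0 z by blast
      moreover have "sgn (v - z) = sgn (v' - z')" using root_sgn_corr[OF c _ _ v'] z by blast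
      moreover have "t < z \<Longrightarrow> v \<le> z" using vmin z by blast
      ultimately show "sgn (t - z) = sgn (x - z')" using x
        by (auto simp: sgn_real_cases)
    qed
    then show thesis using that e(2)[OF x(3)] by blast
  qed
qed

text \<open>The mirror image of \<open>sign_corr_reach_right\<close>: now
  \<open>\<sigma> * p\<close> grows towards the left.\<close>

lemma sign_corr_reach_left:
  assumes c: "sign_corr W R" and fin: "finite W"
    and dpq: "(pderiv p, pderiv q) \<in> W" "pderiv p \<noteq> 0"
    and agree: "\<And>z z'. root_of W z \<Longrightarrow> R z z' \<Longrightarrow> sgn (poly p z) = sgn (poly q z')"
    and nt: "\<not> root_of W t" and t0: "R t t0"
    and s: "\<sigma> \<noteq> 0" "\<sigma> * poly p t \<ge> 0" and d: "\<sigma> * poly (pderiv p) t < 0"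
  obtains t' where "same_pos W R t t'" "\<sigma> * poly q t' > 0"
proof -
  have I0: "same_pos W R t t0" using root_sgn_corr[OF c _ _ t0] by blast
  have dq0: "pderiv q \<noteq> 0" using sign_corrD(3)[OF c dpq(1)] dpq(2) by simp
  show thesis
  proof (cases "\<exists>z. root_of W z \<and> z < t")
    case False
    have I: "same_pos W R t x" if "x \<le> t0" for x
    proof (intro allI impI)
      fix z z' assume z: "root_of W z \<and> R z z'"
      have "t \<noteq> z" using nt z by blast
      moreover have "sgn (t - z) = sgn (t0 - z')" using I0 z by blast
      ultimately show "sgn (t - z) = sgn (x - z')" using that False z
        by (auto simp: sgn_real_cases not_less)
    qed
    have nr: "poly (pderiv q) x \<noteq> 0" if "x \<le> t0" for x
      using same_pos_no_root[OF c nt I[OF that] dpq(1) dq0] .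
    obtain r where r: "\<And>x. r \<le> \<bar>x\<bar> \<Longrightarrow> \<bar>poly q t0\<bar> + 1 \<le> \<bar>poly q x\<bar>"
      using poly_abs_unbounded[OF dq0] by blast
    define x where "x = - \<bar>r\<bar> - \<bar>t0\<bar> - 1"
    have x: "x < t0" "r \<le> \<bar>x\<bar>" by (auto simp: x_def)
    have "sgn (poly q x - poly q t0) = sgn (poly (pderiv q) t0) * sgn (x - t0)"
      by (rule poly_sgn_diff) (use nr x in auto)
    also have "sgn (poly (pderiv q) t0) = sgn (poly (pderiv p) t)"
      using sign_corrD(4)[OF c dpq(1) t0] by simp
    finally have "sgn (poly q x - poly q t0) = - sgn (poly (pderiv p) t)" using x by simp
    then have "sgn (poly q x - poly q t0) = sgn (- poly (pderiv p) t)" by (simp add: sgn_minus)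
    note this[unfolded sgn_real_cases]
    then have "\<sigma> * (poly q x - poly q t0) > 0" using d
      by (auto simp: zero_less_mult_iff mult_less_0_iff sgn_real_cases)
    then have "\<sigma> * poly q x > 0" using r[OF x(2)] s
      by (cases "\<sigma> > 0") (auto simp: zero_less_mult_iff)
    then show thesis by (intro that[OF I[of x]]) (use x in auto)
  next
    case True
    define v where "v = Max {z. root_of W z \<and> z < t}"
    have fin': "finite {z. root_of W z \<and> z < t}" using finite_roots_of[OF fin] by (rule rev_finite_subset) auto
    have "v \<in> {z. root_of W z \<and> z < t}" unfolding v_def by (rule Max_in) (use fin' True in auto)
    then have v: "root_of W v" "v < t" by auto
    have vmax: "z \<le> v" if "root_of W z" "z < t" for z
      unfolding v_def by (rule Max_ge) (use fin' that in auto)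
    obtain v' where v': "R v v'" using sign_corrD(1)[OF c] by blast
    have "sgn (t - v) = sgn (t0 - v')" using I0 v v' by blast
    then have tv': "v' < t0" using v(2) unfolding sgn_real_cases by linarith
    have "sgn (poly p v - poly p t) = sgn (poly (pderiv p) t) * sgn (v - t)"
    proof (rule poly_sgn_diff)
      fix x assume "t \<le> x \<and> x < v \<or> v < x \<and> x \<le> t"
      then have x: "x \<le> t" "v < x" using v by auto
      then have "\<not> root_of W x" using vmax[of x] nt by (cases "t = x") force+
      then show "poly (pderiv p) x \<noteq> 0" using dpq by blast
    qed
    then have "sgn (poly p v - poly p t) = sgn (- poly (pderiv p) t)" using v by (simp add: sgn_minus)
    note this[unfolded sgn_real_cases]
    then have "\<sigma> * (poly p v - poly p t) > 0" using d v
      by (auto simp: zero_less_mult_iff mult_less_0_iff sgn_real_cases)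
    then have "\<sigma> * poly p v > 0" using s(2) by (simp add: algebra_simps)
    then have "\<sigma> * poly q v' > 0" using agree[OF v(1) v'] by (auto simp: zero_less_mult_iff sgn_real_cases)
    then obtain e where e: "e > 0" "\<And>x. \<bar>x - v'\<bar> < e \<Longrightarrow> \<sigma> * poly q x > 0"
      using poly_locally_pos by blast
    define x where "x = min t0 (v' + e / 2)"
    have x: "x \<le> t0" "v' < x" "\<bar>x - v'\<bar> < e" using tv' e(1) by (auto simp: x_def min_def)
    have "same_pos W R t x"
    proof (intro allI impI)
      fix z z' assume z: "root_of W z \<and> R z z'"
      have "t \<noteq> z" using nt z by blast
      moreover have "sgn (t - z) = sgn (t0 - z')" using I0 z by blast
      moreover have "sgn (v - z) = sgn (v' - z')" using root_sgn_corr[OF c _ _ v'] z by blast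
      moreover have "z < t \<Longrightarrow> z \<le> v" using vmax z by blast
      ultimately show "sgn (t - z) = sgn (x - z')" using x
        by (auto simp: sgn_real_cases)
    qed
    then show thesis using that e(2)[OF x(3)] by blast
  qed
qed

text \<open>At a root of the family the old partner matches \<open>p\<close> already, by
  \<open>agree\<close>. Elsewhere a nonzero sign of \<open>p\<close> at \<open>t\<close> is reached
  by moving in the direction in which \<open>p\<close> gains that sign; if \<open>p\<close> vanishes
  at \<open>t\<close>, both signs are reached, and \<open>q\<close> has a zero in between.\<close>

lemma sign_corr_extend_fwd:
  assumes c: "sign_corr W R" and fin: "finite W"
    and dpq: "(pderiv p, pderiv q) \<in> W" "pderiv p \<noteq> 0"
    and agree: "\<And>z z'. root_of W z \<Longrightarrow> R z z' \<Longrightarrow> sgn (poly p z) = sgn (poly q z')"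
  shows "\<exists>t'. same_pos W R t t' \<and> (\<forall>(P, Q)\<in>W. sgn (poly P t) = sgn (poly Q t')) \<and>
           sgn (poly p t) = sgn (poly q t')"
proof -
  obtain t0 where t0: "R t t0" using sign_corrD(1)[OF c] by blast
  have I0: "same_pos W R t t0" using root_sgn_corr[OF c _ _ t0] by blast
  show ?thesis
  proof (cases "root_of W t")
    case True
    then show ?thesis using I0 sign_corrD(4)[OF c _ t0] agree[OF True t0] by blast
  next
    case False
    have W: "sgn (poly P t) = sgn (poly Q t')" if "same_pos W R t t'" "(P, Q) \<in> W" for t' P Q
      using same_pos_sgn[OF c False I0 that] sign_corrD(4)[OF c that(2) t0] by simp
    have d0: "poly (pderiv p) t \<noteq> 0" using False dpq by blast
    have reach: "\<exists>t'. same_pos W R t t' \<and> \<sigma> * poly q t' > 0" if "\<sigma> \<noteq> 0" "\<sigma> * poly p t \<ge> 0" for \<sigma>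
    proof (cases "\<sigma> * poly (pderiv p) t > 0")
      case True
      show ?thesis
        by (rule sign_corr_reach_right[OF c fin dpq agree False t0 that True]) blast+
    next
      case f: False
      then have "\<sigma> * poly (pderiv p) t < 0" using d0 that
        by (metis linorder_less_linear mult_eq_0_iff)
      show ?thesis
        by (rule sign_corr_reach_left[OF c fin dpq agree False t0 that \<open>_ < 0\<close>]) blast+
    qed
    have "\<exists>t'. same_pos W R t t' \<and> sgn (poly p t) = sgn (poly q t')"
    proof -
      consider "poly p t > 0" | "poly p t < 0" | "poly p t = 0" by linarith
      then show ?thesis
      proof cases
        case 1
        obtain a where a: "same_pos W R t a" "poly q a > 0" using reach[of 1] 1 by auto
        then have "sgn (poly p t) = sgn (poly q a)" using 1 by simp
        then show ?thesis using a(1) by blast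
      next
        case 2
        obtain a where a: "same_pos W R t a" "poly q a < 0" using reach[of "-1"] 2 by auto
        then have "sgn (poly p t) = sgn (poly q a)" using 2 by simp
        then show ?thesis using a(1) by blast
      next
        case 3
        obtain a b where a: "same_pos W R t a" "poly q a > 0" and b: "same_pos W R t b" "poly q b < 0"
          using reach[of 1] reach[of "-1"] 3 by auto
        have "\<exists>x. min a b \<le> x \<and> x \<le> max a b \<and> poly q x = 0"
        proof (rule ccontr)
          assume "\<not> ?thesis"
          then have "sgn (poly q a) = sgn (poly q b)" by (intro poly_sgn_eq_no_root) auto
          then show False using a(2) b(2) by simp
        qed
        then obtain x where x: "min a b \<le> x" "x \<le> max a b" "poly q x = 0" by blast
        have "sgn (poly p t) = sgn (poly q x)" using 3 x(3) by simp
        then show ?thesis using same_pos_convex[OF False a(1) b(1) x(1,2)] by blast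
      qed
    qed
    then obtain t' where "same_pos W R t t'" "sgn (poly p t) = sgn (poly q t')" by blast
    with W[OF this(1)] show ?thesis by (intro exI[of _ t']) auto
  qed
qed

text \<open>The delicate point is order around the roots of \<open>p\<close>, which need not be
  roots of the old family. If no old root lies between \<open>t\<close> and a root \<open>z\<close>
  of \<open>p\<close>, then \<open>p\<close> and \<open>q\<close> are strictly monotone in the same
  sense on the two intervals, and the common sign of \<open>p\<close> at \<open>t\<close> and
  \<open>q\<close> at \<open>t'\<close> tells on which side of the root the point lies.\<close>

lemma sign_corr_insert:
  assumes c: "sign_corr W R" and fin: "finite W"
    and dpq: "(pderiv p, pderiv q) \<in> W" "pderiv p \<noteq> 0"
    and agree: "\<And>z z'. root_of W z \<Longrightarrow> R z z' \<Longrightarrow> sgn (poly p z) = sgn (poly q z')"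
  shows "\<exists>R'. sign_corr (insert (p, q) W) R'"
proof -
  define R' where "R' t t' \<longleftrightarrow> same_pos W R t t' \<and> (\<forall>(P, Q)\<in>W. sgn (poly P t) = sgn (poly Q t')) \<and>
           sgn (poly p t) = sgn (poly q t')" for t t'
  have dq0: "pderiv q \<noteq> 0" using sign_corrD(3)[OF c dpq(1)] dpq(2) by simp
  have pq0: "p \<noteq> 0" "q \<noteq> 0" using dpq dq0 by auto
  have root_conv: "root_of W z \<longleftrightarrow> root_of (W\<inverse>) z'" if "R z z'" for z z'
  proof -
    have "(P \<noteq> 0 \<and> poly P z = 0) = (Q \<noteq> 0 \<and> poly Q z' = 0)" if "(P, Q) \<in> W" for P Q
      using sign_corrD(3)[OF c that] sign_corrD(4)[OF c that \<open>R z z'\<close>] by (metis sgn_eq_0_iff)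
    then show ?thesis by blast
  qed
  have fwd: "\<exists>t'. R' t t'" for t
    unfolding R'_def by (rule sign_corr_extend_fwd[OF c fin dpq agree])
  have bwd: "\<exists>t. R' t t'" for t'
  proof -
    have "\<exists>t. same_pos (W\<inverse>) (\<lambda>x y. R y x) t' t \<and> (\<forall>(P, Q)\<in>W\<inverse>. sgn (poly P t') = sgn (poly Q t)) \<and>
           sgn (poly q t') = sgn (poly p t)"
      by (rule sign_corr_extend_fwd[OF sign_corr_converse[OF c]])
        (use fin dpq dq0 agree root_conv in auto)
    then obtain t where t: "same_pos (W\<inverse>) (\<lambda>x y. R y x) t' t" "\<forall>(P, Q)\<in>W\<inverse>. sgn (poly P t') = sgn (poly Q t)"
           "sgn (poly q t') = sgn (poly p t)" by blast
    have "same_pos W R t t'"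
    proof (intro allI impI)
      fix z z' assume "root_of W z \<and> R z z'"
      then have "sgn (t' - z') = sgn (t - z)" using t(1) root_conv by blast
      then show "sgn (t - z) = sgn (t' - z')" by simp
    qed
    moreover have "\<forall>(P, Q)\<in>W. sgn (poly P t) = sgn (poly Q t')"
    proof clarify
      fix P Q assume "(P, Q) \<in> W"
      then have "(Q, P) \<in> W\<inverse>" by simp
      with t(2) have "sgn (poly Q t') = sgn (poly P t)" by blast
      then show "sgn (poly P t) = sgn (poly Q t')" by simp
    qed
    ultimately show ?thesis unfolding R'_def using t(3) by auto
  qed
  \<comment> \<open>At roots of the old family \<open>R'\<close> is contained in \<open>R\<close>:
    comparing \<open>z\<close> with itself pins down its partner.\<close>
  have R'_R: "R z z'" if "root_of W z" "R' z z'" for z z'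
  proof -
    obtain z0 where z0: "R z z0" using sign_corrD(1)[OF c] by blast
    then have "sgn (z - z) = sgn (z' - z0)" using that unfolding R'_def by blast
    then show ?thesis using z0 by (simp add: sgn_eq_0_iff)
  qed
  have ord: "sgn (t - z) = sgn (t' - z')" if "root_of W z" "R' z z'" "R' t t'" for z z' t t'
    using that R'_R[OF that(1,2)] unfolding R'_def by blast
  have new: "sgn (t - z) = sgn (t' - z')" if pz: "poly p z = 0" and z: "R' z z'" and t: "R' t t'" for z z' t t'
  proof (cases "\<exists>z0. root_of W z0 \<and> min t z \<le> z0 \<and> z0 \<le> max t z")
    case True
    \<comment> \<open>An old root between \<open>t\<close> and \<open>z\<close> separates their
      partners in the same way.\<close>
    then obtain z0 where z0: "root_of W z0" "min t z \<le> z0" "z0 \<le> max t z" by blast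
    obtain z0' where "R' z0 z0'" using fwd by blast
    from ord[OF z0(1) this z] ord[OF z0(1) this t] z0(2,3)
    show ?thesis by (auto simp: sgn_real_cases)
  next
    case False
    have F': "\<not> root_of (W\<inverse>) z0'" if z0': "min t' z' \<le> z0'" "z0' \<le> max t' z'" for z0'
    proof
      assume r: "root_of (W\<inverse>) z0'"
      obtain z0 where z0: "R' z0 z0'" using bwd by blast
      have r0: "root_of W z0"
      proof -
        from r obtain P Q where PQ: "(P, Q) \<in> W" "Q \<noteq> 0" "poly Q z0' = 0" by auto
        then have "sgn (poly P z0) = sgn (poly Q z0')" using z0 unfolding R'_def by blast
        with PQ sign_corrD(3)[OF c PQ(1)] show ?thesis by (auto simp: sgn_eq_0_iff)
      qed
      have "min t z \<le> z0 \<and> z0 \<le> max t z"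
        using ord[OF r0 z0 z] ord[OF r0 z0 t] z0' unfolding sgn_real_cases by linarith
      then show False using False r0 by blast
    qed
    have qz: "poly q z' = 0" using z pz unfolding R'_def by (simp add: sgn_eq_0_iff)
    have F1: "\<not> root_of W x" if "t \<le> x \<and> x < z \<or> z < x \<and> x \<le> t" for x
    proof -
      have "min t z \<le> x \<and> x \<le> max t z" using that by auto
      then show ?thesis using False by blast
    qed
    have 1: "sgn (poly p z - poly p t) = sgn (poly (pderiv p) t) * sgn (z - t)"
      by (rule poly_sgn_diff) (use F1 dpq in blast)
    have 2: "sgn (poly q z' - poly q t') = sgn (poly (pderiv q) t') * sgn (z' - t')"
    proof (rule poly_sgn_diff)
      fix x assume "t' \<le> x \<and> x < z' \<or> z' < x \<and> x \<le> t'"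
      then have "min t' z' \<le> x" "x \<le> max t' z'" by auto
      then have "\<not> root_of (W\<inverse>) x" using F'[of x] by blast
      then show "poly (pderiv q) x \<noteq> 0" using dpq(1) dq0 by blast
    qed
    have "min t z \<le> t \<and> t \<le> max t z" by auto
    then have "\<not> root_of W t" using False by blast
    then have d0: "poly (pderiv p) t \<noteq> 0" using dpq by blast
    have "sgn (poly (pderiv p) t) = sgn (poly (pderiv q) t')" "sgn (poly p t) = sgn (poly q t')"
      using t dpq unfolding R'_def by blast+
    then have "sgn (poly (pderiv p) t) * sgn (z - t) = sgn (poly (pderiv p) t) * sgn (z' - t')"
      using 1 2 pz qz by (simp add: sgn_minus)
    then have "sgn (z - t) = sgn (z' - t')" using d0 by (simp add: sgn_eq_0_iff)
    then show ?thesis by (auto simp: sgn_real_cases)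
  qed
  have "sign_corr (insert (p, q) W) R'"
  proof (rule sign_corrI)
    show "P = 0 \<longleftrightarrow> Q = 0" if "(P, Q) \<in> insert (p, q) W" for P Q
      using that pq0 sign_corrD(3)[OF c] by auto
    show "sgn (poly P t) = sgn (poly Q t')" if "(P, Q) \<in> insert (p, q) W" "R' t t'" for P Q t t'
      using that unfolding R'_def by auto
    show "sgn (t - z) = sgn (t' - z')"
      if "(P, Q) \<in> insert (p, q) W" "P \<noteq> 0" "poly P z = 0" "R' z z'" "R' t t'" for P Q z z' t t'
      using that(1)
    proof (cases "(P, Q) = (p, q)")
      case True
      then show ?thesis using new that(3-5) by simp
    next
      case False
      then have "root_of W z" using that(1-3) by blast
      then show ?thesis using ord that(4,5) by blast
    qed
  qed (use fwd bwd in auto)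
  then show ?thesis by blast
qed

section \<open>Elimination of a variable\<close>

inductive_set polyfun :: "nat set \<Rightarrow> ((nat \<Rightarrow> real) \<Rightarrow> real) set" for V where
  const: "(\<lambda>x. c) \<in> polyfun V"
| var: "i \<in> V \<Longrightarrow> (\<lambda>x. x i) \<in> polyfun V"
| add: "f \<in> polyfun V \<Longrightarrow> g \<in> polyfun V \<Longrightarrow> (\<lambda>x. f x + g x) \<in> polyfun V"
| mult: "f \<in> polyfun V \<Longrightarrow> g \<in> polyfun V \<Longrightarrow> (\<lambda>x. f x * g x) \<in> polyfun V"

lemma polyfun_uminus: "f \<in> polyfun V \<Longrightarrow> (\<lambda>x. - f x) \<in> polyfun V"
  using polyfun.mult[OF polyfun.const[of "-1"]] by simp

lemma polyfun_diff: "f \<in> polyfun V \<Longrightarrow> g \<in> polyfun V \<Longrightarrow> (\<lambda>x. f x - g x) \<in> polyfun V"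
  using polyfun.add[OF _ polyfun_uminus, of f V g] by simp

lemma polyfun_power: "f \<in> polyfun V \<Longrightarrow> (\<lambda>x. f x ^ k) \<in> polyfun V"
  by (induction k) (auto intro: polyfun.intros)

lemma polyfun_sum: "(\<And>i. i \<in> I \<Longrightarrow> f i \<in> polyfun V) \<Longrightarrow> (\<lambda>x. \<Sum>i\<in>I. f i x) \<in> polyfun V"
  by (induction I rule: infinite_finite_induct) (auto intro: polyfun.intros)

lemma polyfun_prod: "(\<And>i. i \<in> I \<Longrightarrow> f i \<in> polyfun V) \<Longrightarrow> (\<lambda>x. \<Prod>i\<in>I. f i x) \<in> polyfun V"
  by (induction I rule: infinite_finite_induct) (auto intro: polyfun.intros)

lemmas polyfun_intros = polyfun.intros polyfun_uminus polyfun_diff polyfun_power polyfun_sum polyfun_prod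

lemma polyfun_mono: "f \<in> polyfun V \<Longrightarrow> V \<subseteq> W \<Longrightarrow> f \<in> polyfun W"
  by (induction rule: polyfun.induct) (auto intro: polyfun.intros)

lemma polyfun_cong: "f \<in> polyfun V \<Longrightarrow> (\<And>i. i \<in> V \<Longrightarrow> x i = y i) \<Longrightarrow> f x = f y"
  by (induction rule: polyfun.induct) auto

text \<open>The degree \<open>d\<close> is formal: the coefficient of \<open>d\<close> may vanish at some points.\<close>

definition param_poly :: "nat set \<Rightarrow> nat \<Rightarrow> ((nat \<Rightarrow> real) \<Rightarrow> real poly) set" where
  "param_poly V d = {p. (\<forall>x. degree (p x) \<le> d) \<and> (\<forall>i. (\<lambda>x. coeff (p x) i) \<in> polyfun V)}"

lemma param_polyI:
  assumes "\<And>x. degree (p x) \<le> d" "\<And>i. (\<lambda>x. coeff (p x) i) \<in> polyfun V"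
  shows "p \<in> param_poly V d"
  using assms by (simp add: param_poly_def)

lemma param_polyD:
  assumes "p \<in> param_poly V d"
  shows "degree (p x) \<le> d" "(\<lambda>x. coeff (p x) i) \<in> polyfun V"
  using assms by (auto simp: param_poly_def)

lemma param_poly_mono: "p \<in> param_poly V d \<Longrightarrow> d \<le> e \<Longrightarrow> p \<in> param_poly V e"
  unfolding param_poly_def using order_trans by blast

lemma param_poly_add:
  "p \<in> param_poly V d \<Longrightarrow> q \<in> param_poly V d \<Longrightarrow> (\<lambda>x. p x + q x) \<in> param_poly V d"
  by (auto simp: param_poly_def intro: degree_add_le polyfun.add)

lemma param_poly_mult:
  assumes "p \<in> param_poly V d" "q \<in> param_poly V e"
  shows "(\<lambda>x. p x * q x) \<in> param_poly V (d + e)"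
proof (rule param_polyI)
  show "degree (p x * q x) \<le> d + e" for x
    using degree_mult_le[of "p x" "q x"] param_polyD(1)[OF assms(1), of x] param_polyD(1)[OF assms(2), of x] by linarith
  show "(\<lambda>x. coeff (p x * q x) i) \<in> polyfun V" for i
    unfolding coeff_mult by (intro polyfun_intros param_polyD[OF assms(1)] param_polyD[OF assms(2)])
qed

lemma param_poly_coeff_const:
  assumes "f \<in> polyfun V" shows "(\<lambda>x. [:f x:]) \<in> param_poly V 0"
proof (rule param_polyI)
  show "(\<lambda>x. coeff [:f x:] i) \<in> polyfun V" for i
    using assms polyfun.const[of 0 V] by (cases i) simp_all
qed simp

lemma param_poly_smult:
  assumes "f \<in> polyfun V" "p \<in> param_poly V d"
  shows "(\<lambda>x. smult (f x) (p x)) \<in> param_poly V d"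
  using param_poly_mult[OF param_poly_coeff_const[OF assms(1)] assms(2)] by simp

lemma param_poly_pderiv:
  assumes "p \<in> param_poly V d"
  shows "(\<lambda>x. pderiv (p x)) \<in> param_poly V (d - 1)"
  using param_polyD[OF assms]
  by (auto intro!: param_polyI polyfun.mult polyfun.const simp: coeff_pderiv degree_pderiv diff_le_mono)

lemma param_poly_truncate:
  assumes "p \<in> param_poly V d"
  shows "(\<lambda>x. p x - monom (coeff (p x) d) d) \<in> param_poly V (d - 1)"
proof (rule param_polyI)
  show "degree (p x - monom (coeff (p x) d) d) \<le> d - 1" for x
  proof (rule degree_le, intro allI impI)
    fix i assume "d - 1 < i"
    then show "coeff (p x - monom (coeff (p x) d) d) i = 0"
      using param_polyD(1)[OF assms, of x] by (cases "i = d") (auto simp: coeff_eq_0)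
  qed
  have "(\<lambda>x. coeff (p x - monom (coeff (p x) d) d) i) = (if i = d then (\<lambda>x. 0) else (\<lambda>x. coeff (p x) i))" for i
    by auto
  then show "(\<lambda>x. coeff (p x - monom (coeff (p x) d) d) i) \<in> polyfun V" for i
    using param_polyD(2)[OF assms, of i] polyfun.const[of 0 V] by simp
qed

text \<open>Division that multiplies by the leading coefficient of the divisor instead of dividing
  by it, so that the coefficients of the remainder stay polynomial in the parameters. The
  divisibility also holds at points where that coefficient vanishes.\<close>

lemma param_poly_pseudo_rem:
  assumes "p \<in> param_poly V d" "q \<in> param_poly V e" "e \<ge> 1"
  shows "\<exists>r k. r \<in> param_poly V (e - 1) \<and> (\<forall>x. q x dvd smult (coeff (q x) e ^ k) (p x) - r x)"
  using assms(1)
proof (induction d arbitrary: p rule: less_induct)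
  case (less d)
  show ?case
  proof (cases "d < e")
    case True
    then have "p \<in> param_poly V (e - 1)" using less.prems by (auto elim: param_poly_mono)
    then show ?thesis by (intro exI[of _ p] exI[of _ 0]) simp
  next
    case False
    define p1 where "p1 x = smult (coeff (q x) e) (p x) - monom (coeff (p x) d) (d - e) * q x" for x
    have ent: "(\<lambda>x. smult (coeff (q x) e) (p x)) \<in> param_poly V d"
      by (intro param_poly_smult param_polyD(2)[OF assms(2)] less.prems)
    have m: "(\<lambda>x. monom (- coeff (p x) d) (d - e)) \<in> param_poly V (d - e)"
    proof (rule param_polyI)
      show "(\<lambda>x. coeff (monom (- coeff (p x) d) (d - e)) i) \<in> polyfun V" for i
        using polyfun_uminus[OF param_polyD(2)[OF less.prems, of d]] polyfun.const[of 0 V]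
        by (cases "i = d - e") simp_all
    qed (rule degree_monom_le)
    have "(\<lambda>x. monom (- coeff (p x) d) (d - e) * q x) \<in> param_poly V d"
      using param_poly_mult[OF m assms(2)] False by simp
    from param_poly_add[OF ent this] have p1: "p1 \<in> param_poly V d"
      by (simp add: p1_def[abs_def] minus_monom[symmetric])
    have "coeff (p1 x) d = 0" for x
    proof -
      have "coeff (monom (coeff (p x) d) (d - e) * q x) d = coeff (p x) d * coeff (q x) e"
        using False by (simp add: coeff_monom_mult)
      then show ?thesis by (simp add: p1_def)
    qed
    then have p1': "p1 \<in> param_poly V (d - 1)" using param_poly_truncate[OF p1] by simp
    have "d - 1 < d" using False assms(3) by simp
    from less.IH[OF this p1'] obtain r k where r: "r \<in> param_poly V (e - 1)"
      "\<And>x. q x dvd smult (coeff (q x) e ^ k) (p1 x) - r x" by blast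
    have "q x dvd smult (coeff (q x) e ^ Suc k) (p x) - r x" for x
    proof -
      have "smult (coeff (q x) e ^ Suc k) (p x) - r x =
        (smult (coeff (q x) e ^ k) (p1 x) - r x) + q x * smult (coeff (q x) e ^ k) (monom (coeff (p x) d) (d - e))"
        by (simp add: p1_def algebra_simps smult_diff_right)
      then show ?thesis by (simp only:) (intro dvd_add r(2) dvd_triv_left)
    qed
    then show ?thesis using r(1) by blast
  qed
qed

text \<open>At a root of \<open>q\<close> the remainder equals \<open>c ^ k\<close> times
  \<open>p\<close>, and \<open>sgn c ^ k\<close> is its own inverse.\<close>

lemma pseudo_rem_sgn:
  fixes p q r :: "real poly"
  assumes "q dvd smult (c ^ k) p - r" "poly q z = 0" "c \<noteq> 0"
  shows "sgn (poly p z) = sgn (poly r z) * sgn c ^ k"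
proof -
  obtain u where "smult (c ^ k) p - r = q * u" using assms(1) by blast
  then have "poly (smult (c ^ k) p - r) z = 0" using assms(2) by simp
  then have "poly r z = c ^ k * poly p z" by simp
  then have r: "sgn (poly r z) * sgn c ^ k = sgn (poly p z) * (sgn c ^ k * sgn c ^ k)" by (simp add: sgn_mult power_sgn)
  moreover have "sgn c ^ k * sgn c ^ k = 1"
    using assms(3) by (simp add: power_mult_distrib[symmetric] sgn_if)
  ultimately show ?thesis by simp
qed

lemma sign_corr_subset:
  assumes "sign_corr W R" "W' \<subseteq> W"
  shows "sign_corr W' R"
proof (rule sign_corrI)
  show "sgn (t - z) = sgn (t' - z')"
    if "(P, Q) \<in> W'" "P \<noteq> 0" "poly P z = 0" "R z z'" "R t t'" for P Q z z' t t'
    using sign_corrD(5)[OF assms(1) subsetD[OF assms(2) that(1)] that(2-5)] .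
qed (use sign_corrD(1-4)[OF assms(1)] assms(2) in \<open>simp_all add: subset_iff\<close>)

abbreviation sgn_eq_on where
  "sgn_eq_on G x y \<equiv> \<forall>g\<in>G. sgn (g x :: real) = sgn (g y)"

abbreviation poly_pairs where
  "poly_pairs F x y \<equiv> (\<lambda>p. (p x, p y)) ` F"

text \<open>Cohen--Hoermander elimination.  Where all leading coefficients are nonzero, a polynomial \<open>p\<close> of
  maximal degree is replaced by its derivative and its remainders modulo the derivative and the other
  polynomials: at a root of such a divisor, the sign of \<open>p\<close> is that of the remainder.  Elsewhere a
  polynomial loses its leading term.  Both steps decrease the multiset of formal degrees.\<close>

lemma param_poly_sign_corr:
  fixes M :: "(((nat \<Rightarrow> real) \<Rightarrow> real poly) \<times> nat) multiset"
  assumes "\<And>p d. (p, d) \<in># M \<Longrightarrow> p \<in> param_poly V d"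
  shows "\<exists>G. finite G \<and> G \<subseteq> polyfun V \<and>
           (\<forall>x y. sgn_eq_on G x y \<longrightarrow> (\<exists>R. sign_corr (poly_pairs (fst ` set_mset M) x y) R))"
proof -
  have "wf (inv_image (mult less_than) (image_mset (snd :: ((nat \<Rightarrow> real) \<Rightarrow> real poly) \<times> nat \<Rightarrow> nat)))"
    by (intro wf_inv_image wf_mult wf_less_than)
  then show ?thesis using assms
  proof (induction M rule: wf_induct_rule)
    case (less M)
    note IH = less.IH
    show ?case
    proof (cases "\<exists>(p, d)\<in>#M. d \<ge> 1")
      case False
      define G where "G = (\<lambda>p x. coeff (p x) 0) ` fst ` set_mset M"
      have G: "finite G" "G \<subseteq> polyfun V"
        using less.prems param_polyD(2) by (fastforce simp: G_def)+
      \<comment> \<open>All members are constant polynomials at each point, so equal signs of their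
        coefficients make the identity a correspondence.\<close>
      have "sign_corr (poly_pairs (fst ` set_mset M) x y) (=)" if xy: "sgn_eq_on G x y" for x y
      proof -
        have *: "\<exists>a b. P = [:a:] \<and> Q = [:b:] \<and> sgn a = sgn b"
          if "(P, Q) \<in> poly_pairs (fst ` set_mset M) x y" for P Q
        proof -
          from that obtain p d where p: "(p, d) \<in># M" "P = p x" "Q = p y" by auto
          with False have "d = 0" by auto
          with less.prems[OF p(1)] have "degree P = 0" "degree Q = 0"
            using param_polyD(1)[of p V 0] p by auto
          then have "P = [:coeff P 0:]" "Q = [:coeff Q 0:]"
            by (metis degree_eq_zeroE coeff_pCons_0)+
          moreover have "sgn (coeff P 0) = sgn (coeff Q 0)"
            using xy p unfolding G_def by force
          ultimately show ?thesis by blast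
        qed
        show ?thesis
        proof (rule sign_corrI)
          show "(P = 0) = (Q = 0)" if "(P, Q) \<in> poly_pairs (fst ` set_mset M) x y" for P Q
            using *[OF that] by (auto simp: sgn_eq_0_iff)
          show "sgn (poly P t) = sgn (poly Q t')"
            if "(P, Q) \<in> poly_pairs (fst ` set_mset M) x y" "t = t'" for P Q t t'
            using *[OF that(1)] by auto
        qed auto
      qed
      then show ?thesis using G by blast
    next
      case True
      define D where "D = snd ` set_mset M"
      have "finite D" "D \<noteq> {}" using True by (auto simp: D_def)
      then have "Max D \<in> D" by simp
      then obtain p where pM: "(p, Max D) \<in># M" by (auto simp: D_def)
      define d where "d = Max D"
      have dmax: "e \<le> d" if "(q, e) \<in># M" for q e
        unfolding d_def using that \<open>finite D\<close> by (intro Max_ge) (auto simp: D_def image_iff intro!: bexI)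
      have d1: "d \<ge> 1" using True dmax by force
      have pM: "(p, d) \<in># M" using pM d_def by simp
      have pP: "p \<in> param_poly V d" using less.prems[OF pM] .
      define p' where "p' x = pderiv (p x)" for x
      have p'P: "p' \<in> param_poly V (d - 1)" using param_poly_pderiv[OF pP] by (simp add: p'_def[abs_def])
      have p'c: "coeff (p' x) (d - 1) = of_nat d * coeff (p x) d" for x
        using d1 by (simp add: p'_def coeff_pderiv)
      define M0 where "M0 = M - {#(p, d)#}"
      have M: "M = add_mset (p, d) M0" using pM by (simp add: M0_def)
      define M1 where "M1 = add_mset (p', d - 1) M0"
      have M1P: "q \<in> param_poly V e" if "(q, e) \<in># M1" for q e
        using that less.prems p'P by (auto simp: M1_def M)
      have M1d: "e \<le> d" if "(q, e) \<in># M1" for q e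
        using that dmax by (force simp: M1_def M)
      have "\<forall>q e. \<exists>r k. (q, e) \<in># M1 \<and> e \<ge> 1 \<longrightarrow>
          r \<in> param_poly V (e - 1) \<and> (\<forall>x. q x dvd smult (coeff (q x) e ^ k) (p x) - r x)"
        using param_poly_pseudo_rem[OF pP M1P] by blast
      then obtain rem kk where "\<forall>q e. (q, e) \<in># M1 \<and> e \<ge> 1 \<longrightarrow>
          rem q e \<in> param_poly V (e - 1) \<and> (\<forall>x. q x dvd smult (coeff (q x) e ^ kk q e) (p x) - rem q e x)"
        unfolding choice_iff by blast
      then have rem: "rem q e \<in> param_poly V (e - 1)"
        "q x dvd smult (coeff (q x) e ^ kk q e) (p x) - rem q e x" if "(q, e) \<in># M1" "e \<ge> 1" for q e x
        using that by auto
      define M1' where "M1' = filter_mset (\<lambda>(q, e). e \<ge> 1) M1"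
      \<comment> \<open>The divisors include \<open>p'\<close> and have formal degree at most
        \<open>d\<close>, so \<open>p'\<close> and all remainders lie below \<open>d\<close>: one
        entry \<open>d\<close> is traded for finitely many smaller ones.\<close>
      define Mr where "Mr = image_mset (\<lambda>(q, e). (rem q e, e - 1)) M1'"
      have Mr: "\<exists>G. finite G \<and> G \<subseteq> polyfun V \<and>
           (\<forall>x y. sgn_eq_on G x y \<longrightarrow> (\<exists>R. sign_corr (poly_pairs (fst ` set_mset (M1 + Mr)) x y) R))"
      proof (rule IH)
        have "(image_mset snd M0 + image_mset snd (add_mset (p', d - 1) Mr), image_mset snd M0 + {#d#}) \<in> mult less_than"
          by (rule one_step_implies_mult) (use d1 M1d in \<open>fastforce simp: Mr_def M1'_def\<close>)+
        then show "(M1 + Mr, M) \<in> inv_image (mult less_than) (image_mset snd)"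
          by (simp add: M M1_def)
        show "q \<in> param_poly V e" if "(q, e) \<in># M1 + Mr" for q e
          using that M1P rem(1) by (auto simp: Mr_def M1'_def)
      qed
      then obtain Gr where Gr: "finite Gr" "Gr \<subseteq> polyfun V"
        "\<And>x y. sgn_eq_on Gr x y \<Longrightarrow> \<exists>R. sign_corr (poly_pairs (fst ` set_mset (M1 + Mr)) x y) R"
        by blast
      define tr :: "((nat \<Rightarrow> real) \<Rightarrow> real poly) \<Rightarrow> nat \<Rightarrow> (nat \<Rightarrow> real) \<Rightarrow> real poly"
        where "tr q e = (\<lambda>x. q x - monom (coeff (q x) e) e)" for q e
      have "\<exists>G. finite G \<and> G \<subseteq> polyfun V \<and>
           (\<forall>x y. sgn_eq_on G x y \<longrightarrow> (\<exists>R. sign_corr (poly_pairs (fst ` set_mset (add_mset (tr q e, e - 1) (M - {#(q, e)#}))) x y) R))"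
        if q: "(q, e) \<in># M" "e \<ge> 1" for q e
      proof (rule IH)
        have M: "M = add_mset (q, e) (M - {#(q, e)#})" using q by simp
        have "(image_mset snd (M - {#(q, e)#}) + {#e - 1#}, image_mset snd (M - {#(q, e)#}) + {#e#}) \<in> mult less_than"
          by (rule one_step_implies_mult) (use q in auto)
        also have "image_mset snd (M - {#(q, e)#}) + {#e#} = image_mset snd M"
          by (subst (2) M) simp
        finally show "(add_mset (tr q e, e - 1) (M - {#(q, e)#}), M) \<in> inv_image (mult less_than) (image_mset snd)"
          by simp
        show "f \<in> param_poly V i" if "(f, i) \<in># add_mset (tr q e, e - 1) (M - {#(q, e)#})" for f i
          using that param_poly_truncate[OF less.prems[OF q(1)]] less.prems
          by (auto simp: tr_def dest: in_diffD)
      qed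
      then have "\<forall>qe. \<exists>G. qe \<in># M \<and> snd qe \<ge> 1 \<longrightarrow> finite G \<and> G \<subseteq> polyfun V \<and>
           (\<forall>x y. sgn_eq_on G x y \<longrightarrow> (\<exists>R. sign_corr (poly_pairs (fst ` set_mset
              (add_mset (tr (fst qe) (snd qe), snd qe - 1) (M - {#qe#}))) x y) R))"
        by simp
      then obtain Gt where Gt: "\<forall>qe. qe \<in># M \<and> snd qe \<ge> 1 \<longrightarrow> finite (Gt qe) \<and> Gt qe \<subseteq> polyfun V \<and>
           (\<forall>x y. sgn_eq_on (Gt qe) x y \<longrightarrow> (\<exists>R. sign_corr (poly_pairs (fst ` set_mset
              (add_mset (tr (fst qe) (snd qe), snd qe - 1) (M - {#qe#}))) x y) R))"
        unfolding choice_iff by blast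
      define lead :: "((nat \<Rightarrow> real) \<Rightarrow> real poly) \<times> nat \<Rightarrow> (nat \<Rightarrow> real) \<Rightarrow> real"
        where "lead qe = (\<lambda>x. coeff (fst qe x) (snd qe))" for qe
      \<comment> \<open>The signs of the leading coefficients decide which branch applies, and force
        the same branch at \<open>x\<close> and \<open>y\<close>; the other parts serve the generic
        branch and every possible truncation.\<close>
      define G where "G = lead ` set_mset M \<union> Gr \<union> (\<Union>qe\<in>{qe\<in>set_mset M. snd qe \<ge> 1}. Gt qe)"
      have "finite G" using Gr(1) Gt by (auto simp: G_def)
      moreover have "G \<subseteq> polyfun V"
        using Gr(2) Gt less.prems by (fastforce simp: G_def lead_def intro: param_polyD(2))
      moreover have "\<exists>R. sign_corr (poly_pairs (fst ` set_mset M) x y) R" if xy: "sgn_eq_on G x y" for x y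
      proof -
        have lead: "sgn (lead qe x) = sgn (lead qe y)" if "qe \<in># M" for qe
          using xy that by (auto simp: G_def)
        show ?thesis
        proof (cases "\<exists>qe\<in>#M. snd qe \<ge> 1 \<and> lead qe x = 0")
          case True
          then obtain q e where q: "(q, e) \<in># M" "e \<ge> 1" "lead (q, e) x = 0" by auto
          have "sgn (lead (q, e) y) = 0" using lead[OF q(1)] q(3) by (metis sgn_0)
          then have qy: "lead (q, e) y = 0" by (metis sgn_eq_0_iff)
          have "Gt (q, e) \<subseteq> (\<Union>qe\<in>{qe\<in>set_mset M. snd qe \<ge> 1}. Gt qe)"
            by (rule UN_upper) (use q in simp)
          then have "Gt (q, e) \<subseteq> G" unfolding G_def by (rule le_supI2)
          then have st: "sgn_eq_on (Gt (q, e)) x y" using xy by (metis subsetD)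
          obtain R where R: "sign_corr (poly_pairs (fst ` set_mset
              (add_mset (tr q e, e - 1) (M - {#(q, e)#}))) x y) R"
            using Gt[THEN spec[of _ "(q, e)"], unfolded fst_conv snd_conv, THEN mp[OF _ conjI[OF q(1,2)]],
                THEN conjunct2, THEN conjunct2, THEN spec[of _ x], THEN spec[of _ y], THEN mp, OF st] by (rule exE)
          have tr: "tr q e x = q x" "tr q e y = q y" using q(3) qy by (auto simp: tr_def lead_def)
          have "poly_pairs (fst ` set_mset M) x y = poly_pairs (fst ` set_mset (add_mset (q, e) (M - {#(q, e)#}))) x y"
            by (simp only: insert_DiffM[OF q(1)])
          also have "\<dots> = poly_pairs (fst ` set_mset (add_mset (tr q e, e - 1) (M - {#(q, e)#}))) x y"
            by (simp only: set_mset_add_mset_insert image_insert fst_conv tr)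
          finally show ?thesis using R by auto
        next
          case False
          have nz: "coeff (q x) e \<noteq> 0 \<and> sgn (coeff (q x) e) = sgn (coeff (q y) e)" if q: "(q, e) \<in># M1" "e \<ge> 1" for q e
          proof (cases "(q, e) \<in># M0")
            case True
            then have "(q, e) \<in># M" by (simp add: M)
            then show ?thesis using False q(2) lead[of "(q, e)"] by (auto simp: lead_def)
          next
            case f: False
            then have "q = p'" "e = d - 1" using q by (auto simp: M1_def)
            then show ?thesis using False pM d1 lead[OF pM] p'c by (auto simp: lead_def sgn_mult)
          qed
          have "sgn_eq_on Gr x y" using xy by (auto simp: G_def)
          from Gr(3)[OF this] obtain R where R: "sign_corr (poly_pairs (fst ` set_mset (M1 + Mr)) x y) R" by blast
          define W where "W = poly_pairs (fst ` set_mset M1) x y"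
          have W: "sign_corr W R" by (rule sign_corr_subset[OF R]) (auto simp: W_def)
          have "\<exists>R'. sign_corr (insert (p x, p y) W) R'"
          proof (rule sign_corr_insert[OF W])
            show "finite W" by (simp add: W_def)
            show "(pderiv (p x), pderiv (p y)) \<in> W" by (auto simp: W_def M1_def p'_def)
            have "coeff (p x) d \<noteq> 0" using False pM d1 by (auto simp: lead_def)
            then have "coeff (p' x) (d - 1) \<noteq> 0" using p'c d1 by simp
            then show "pderiv (p x) \<noteq> 0" by (auto simp: p'_def)
            fix z z' assume "root_of W z" and z: "R z z'"
            then obtain q e where q: "(q, e) \<in># M1" "q x \<noteq> 0" "poly (q x) z = 0"
              by (auto simp: W_def)
            \<comment> \<open>A nonzero polynomial of formal degree 0 has no root, so
              \<open>q\<close> is one of the divisors whose remainder is in the family.\<close>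
            have e1: "e \<ge> 1"
            proof (rule ccontr)
              assume "\<not> e \<ge> 1"
              then have "degree (q x) = 0" using param_polyD(1)[OF M1P[OF q(1)], of x] by simp
              then obtain a where "q x = [:a:]" by (metis degree_eq_zeroE)
              then show False using q(2,3) by simp
            qed
            have "q \<in> fst ` set_mset (M1 + Mr)" using q(1) by (metis fst_conv image_eqI union_iff)
            then have "(q x, q y) \<in> poly_pairs (fst ` set_mset (M1 + Mr)) x y" by (rule imageI)
            from sign_corrD(4)[OF R this z] have qy: "poly (q y) z' = 0" using q(3) by (simp add: sgn_eq_0_iff)
            have "(q, e) \<in># M1'" unfolding M1'_def using q(1) e1 by simp
            then have "(\<lambda>(q, e). (rem q e, e - 1)) (q, e) \<in># Mr"
              unfolding Mr_def set_image_mset by (rule imageI)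
            then have "rem q e \<in> fst ` set_mset (M1 + Mr)" by (metis fst_conv image_eqI old.prod.case union_iff)
            then have "(rem q e x, rem q e y) \<in> poly_pairs (fst ` set_mset (M1 + Mr)) x y" by (rule imageI)
            from sign_corrD(4)[OF R this z] have r: "sgn (poly (rem q e x) z) = sgn (poly (rem q e y) z')" .
            note n = nz[OF q(1) e1]
            then have cy: "coeff (q y) e \<noteq> 0" by (auto simp: sgn_real_cases)
            show "sgn (poly (p x) z) = sgn (poly (p y) z')"
              using pseudo_rem_sgn[OF rem(2)[OF q(1) e1] q(3)] n r
                pseudo_rem_sgn[OF rem(2)[OF q(1) e1] qy cy] by simp
          qed
          then obtain R' where "sign_corr (insert (p x, p y) W) R'" by blast
          then have "sign_corr (poly_pairs (fst ` set_mset M) x y) R'"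
            by (rule sign_corr_subset) (auto simp: W_def M M1_def)
          then show ?thesis by blast
        qed
      qed
      ultimately show ?thesis by blast
    qed
  qed
qed

lemma param_poly_cong:
  assumes "p \<in> param_poly V d" "\<And>i. i \<in> V \<Longrightarrow> x i = y i"
  shows "p x = p y"
  by (rule poly_eqI) (use polyfun_cong[OF param_polyD(2)[OF assms(1)]] assms(2) in blast)

lemma polyfun_as_param_poly:
  assumes "f \<in> polyfun (insert v V)"
  shows "\<exists>d p. p \<in> param_poly V d \<and> (\<forall>x. f x = poly (p x) (x v))"
  using assms
proof (induction rule: polyfun.induct)
  case (const c)
  show ?case
    by (rule exI[of _ 0], rule exI[of _ "\<lambda>x. [:c:]"]) (simp add: param_poly_coeff_const polyfun.const)
next
  case (var i)
  show ?case
  proof (cases "i = v")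
    case True
    have "(\<lambda>x. [:0, 1:]) \<in> param_poly V 1"
      by (rule param_polyI) (auto intro: polyfun.const)
    then show ?thesis using True by (intro exI[of _ 1] exI[of _ "\<lambda>x. [:0, 1:]"]) simp
  next
    case False
    then have "(\<lambda>x. [:x i:]) \<in> param_poly V 0" using var by (intro param_poly_coeff_const polyfun.var) auto
    then show ?thesis by (intro exI[of _ 0] exI[of _ "\<lambda>x. [:x i:]"]) simp
  qed
next
  case (add f g)
  then obtain d p e q where *: "p \<in> param_poly V d" "q \<in> param_poly V e"
    "\<And>x. f x = poly (p x) (x v)" "\<And>x. g x = poly (q x) (x v)" by metis
  have "(\<lambda>x. p x + q x) \<in> param_poly V (max d e)"
    by (intro param_poly_add param_poly_mono[OF *(1)] param_poly_mono[OF *(2)]) auto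
  then show ?case using *(3,4) by (intro exI[of _ "max d e"] exI[of _ "\<lambda>x. p x + q x"]) simp
next
  case (mult f g)
  then obtain d p e q where *: "p \<in> param_poly V d" "q \<in> param_poly V e"
    "\<And>x. f x = poly (p x) (x v)" "\<And>x. g x = poly (q x) (x v)" by metis
  then show ?case using param_poly_mult[OF *(1,2)]
    by (intro exI[of _ "d + e"] exI[of _ "\<lambda>x. p x * q x"]) simp
qed

text \<open>Quantifier elimination in terms of sign vectors: the signs of \<open>G\<close> at a
  point determine which sign vectors \<open>F\<close> takes on the line through it in direction
  \<open>v\<close>. The point \<open>t\<close> is the partner of \<open>x v\<close> under the sign
  correspondence.\<close>

lemma eliminate_variable:
  assumes "finite F" "F \<subseteq> polyfun (insert v V)" "v \<notin> V"
  shows "\<exists>G. finite G \<and> G \<subseteq> polyfun V \<and>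
    (\<forall>x y. sgn_eq_on G x y \<longrightarrow> (\<exists>t. \<forall>f\<in>F. sgn (f x) = sgn (f (y(v := t)))))"
proof -
  have "\<forall>f. \<exists>d p. f \<in> F \<longrightarrow> p \<in> param_poly V d \<and> (\<forall>x. f x = poly (p x) (x v))"
    using polyfun_as_param_poly assms(2) by blast
  then obtain dd pp where "\<forall>f. f \<in> F \<longrightarrow> pp f \<in> param_poly V (dd f) \<and> (\<forall>x. f x = poly (pp f x) (x v))"
    unfolding choice_iff by blast
  then have pp: "pp f \<in> param_poly V (dd f)" "f x = poly (pp f x) (x v)" if "f \<in> F" for f x
    using that by blast+
  define M where "M = mset_set ((\<lambda>f. (pp f, dd f)) ` F)"
  have M: "set_mset M = (\<lambda>f. (pp f, dd f)) ` F" using assms(1) by (simp add: M_def)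
  have "\<exists>G. finite G \<and> G \<subseteq> polyfun V \<and>
           (\<forall>x y. sgn_eq_on G x y \<longrightarrow> (\<exists>R. sign_corr (poly_pairs (fst ` set_mset M) x y) R))"
    by (rule param_poly_sign_corr) (use pp in \<open>auto simp: M\<close>)
  then obtain G where G: "finite G" "G \<subseteq> polyfun V"
    "\<And>x y. sgn_eq_on G x y \<Longrightarrow> \<exists>R. sign_corr (poly_pairs (fst ` set_mset M) x y) R" by blast
  have "\<exists>t. \<forall>f\<in>F. sgn (f x) = sgn (f (y(v := t)))" if xy: "sgn_eq_on G x y" for x y
  proof -
    from G(3)[OF xy] obtain R where R: "sign_corr (poly_pairs (fst ` set_mset M) x y) R" by blast
    obtain t where t: "R (x v) t" using sign_corrD(1)[OF R] by blast
    have "sgn (f x) = sgn (f (y(v := t)))" if f: "f \<in> F" for f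
    proof -
      have "pp f \<in> fst ` set_mset M" using f unfolding M by (simp add: image_image)
      then have "(pp f x, pp f y) \<in> poly_pairs (fst ` set_mset M) x y" by (rule imageI)
      from sign_corrD(4)[OF R this t] have "sgn (f x) = sgn (poly (pp f y) t)" by (simp add: pp(2)[OF f])
      also have "pp f y = pp f (y(v := t))"
        by (rule param_poly_cong[OF pp(1)[OF f]]) (use assms(3) in auto)
      finally show ?thesis using pp(2)[OF f, of "y(v := t)"] by simp
    qed
    then show ?thesis by blast
  qed
  then show ?thesis using G(1,2) by blast
qed

lemma eliminate_variables:
  assumes "finite U" "U \<inter> V = {}" "finite F" "F \<subseteq> polyfun (U \<union> V)"
  shows "\<exists>G. finite G \<and> G \<subseteq> polyfun V \<and>
    (\<forall>x y. sgn_eq_on G x y \<longrightarrow> (\<exists>y'. (\<forall>i\<in>V. y' i = y i) \<and> (\<forall>f\<in>F. sgn (f x) = sgn (f y'))))"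
  using assms
proof (induction U arbitrary: F rule: finite_induct)
  case empty
  then show ?case by (intro exI[of _ F]) auto
next
  case (insert v U)
  have "F \<subseteq> polyfun (insert v (U \<union> V))" "v \<notin> U \<union> V" using insert by auto
  from eliminate_variable[OF insert.prems(2) this] obtain G1 where
    G1: "finite G1" "G1 \<subseteq> polyfun (U \<union> V)"
    "\<And>x y. sgn_eq_on G1 x y \<Longrightarrow> \<exists>t. \<forall>f\<in>F. sgn (f x) = sgn (f (y(v := t)))" by blast
  have "U \<inter> V = {}" using insert.prems by auto
  from insert.IH[OF this G1(1,2)] obtain G where
    G: "finite G" "G \<subseteq> polyfun V"
    "\<And>x y. sgn_eq_on G x y \<Longrightarrow> \<exists>y'. (\<forall>i\<in>V. y' i = y i) \<and> sgn_eq_on G1 x y'" by blast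
  have "\<exists>y'. (\<forall>i\<in>V. y' i = y i) \<and> (\<forall>f\<in>F. sgn (f x) = sgn (f y'))" if xy: "sgn_eq_on G x y" for x y
  proof -
    obtain y' where y': "\<forall>i\<in>V. y' i = y i" "sgn_eq_on G1 x y'" using G(3)[OF xy] by blast
    obtain t where "\<forall>f\<in>F. sgn (f x) = sgn (f (y'(v := t)))" using G1(3)[OF y'(2)] by blast
    moreover have "\<forall>i\<in>V. (y'(v := t)) i = y i" using y'(1) insert.prems(1) by auto
    ultimately show ?thesis by blast
  qed
  then show ?case using G(1,2) by blast
qed

section \<open>The Lojasiewicz inequality\<close>

text \<open>The outer variable is \<open>x a\<close>, and the coefficients are polynomials in
  \<open>x b\<close>: on a cusp where \<open>x a\<close> is much smaller than \<open>x b\<close>,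
  the lowest power of \<open>x a\<close> dominates.\<close>

lemma polyfun_two_vars:
  assumes "f \<in> polyfun {a, b}"
  shows "\<exists>P :: real poly poly. \<forall>x. f x = poly (poly P [:x a:]) (x b)"
  using assms
proof (induction rule: polyfun.induct)
  case (const c)
  show ?case by (rule exI[of _ "[:[:c:]:]"]) simp
next
  case (var i)
  then consider "i = a" | "i = b" by blast
  then show ?case
  proof cases
    case 1
    then show ?thesis by (intro exI[of _ "[:0, 1:]"]) simp
  next
    case 2
    then show ?thesis by (intro exI[of _ "[:[:0, 1:]:]"]) simp
  qed
next
  case (add f g)
  then obtain P Q where "\<And>x. f x = poly (poly P [:x a:]) (x b)" "\<And>x. g x = poly (poly Q [:x a:]) (x b)" by metis
  then show ?case by (intro exI[of _ "P + Q"]) simp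
next
  case (mult f g)
  then obtain P Q where "\<And>x. f x = poly (poly P [:x a:]) (x b)" "\<And>x. g x = poly (poly Q [:x a:]) (x b)" by metis
  then show ?case by (intro exI[of _ "P * Q"]) simp
qed

lemma poly_poly_bounded:
  fixes Q :: "real poly poly"
  shows "\<exists>C\<ge>0. \<forall>s t. 0 \<le> s \<longrightarrow> s \<le> 1 \<longrightarrow> 0 \<le> t \<longrightarrow> t \<le> 1 \<longrightarrow> \<bar>poly (poly Q [:s:]) t\<bar> \<le> C"
proof (induction Q)
  case 0
  show ?case by (rule exI[of _ 0]) simp
next
  case (pCons a Q)
  then obtain C where C: "C \<ge> 0" "\<And>s t. 0 \<le> s \<Longrightarrow> s \<le> 1 \<Longrightarrow> 0 \<le> t \<Longrightarrow> t \<le> 1 \<Longrightarrow> \<bar>poly (poly Q [:s:]) t\<bar> \<le> C" by blast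
  obtain m where m: "m > 0" "\<And>t. norm t \<le> 1 \<Longrightarrow> norm (poly a t) \<le> m" using poly_bound_exists[of 1 a] by blast
  have "\<bar>poly (poly (pCons a Q) [:s:]) t\<bar> \<le> m + C" if st: "0 \<le> s" "s \<le> 1" "0 \<le> t" "t \<le> 1" for s t
  proof -
    have "\<bar>poly (poly (pCons a Q) [:s:]) t\<bar> \<le> \<bar>poly a t\<bar> + \<bar>s * poly (poly Q [:s:]) t\<bar>" by simp
    also have "\<bar>poly a t\<bar> \<le> m" using m(2)[of t] st by simp
    also have "\<bar>s * poly (poly Q [:s:]) t\<bar> \<le> 1 * C"
      unfolding abs_mult by (rule mult_mono) (use st C in auto)
    finally show ?thesis by simp
  qed
  then show ?case using m(1) C(1) by (intro exI[of _ "m + C"]) auto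
qed

lemma poly_split_zero:
  fixes p :: "'a::idom poly"
  assumes "p \<noteq> 0"
  obtains k q where "p = [:0, 1:] ^ k * q" "poly q 0 \<noteq> 0"
proof -
  obtain q where "p = [:- 0, 1:] ^ order 0 p * q" "\<not> [:- 0, 1:] dvd q"
    using order_decomp[OF assms] by blast
  then show thesis using that[of "order 0 p" q] by (simp add: poly_eq_0_iff_dvd)
qed

text \<open>Pulling out the highest possible power of \<open>s\<close> leaves a term
  \<open>t ^ m\<close> times \<open>r1\<close>, with \<open>r1\<close> nonzero at 0, plus
  \<open>s\<close> times a bounded term. For \<open>s < t ^ Suc m\<close> the latter is smaller by a
  factor of order \<open>t\<close>, so the sign is that of \<open>r1\<close> at 0.\<close>

lemma poly_poly_sgn_cusp:
  fixes P :: "real poly poly"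
  shows "\<exists>N e \<sigma>. e > 0 \<and> e \<le> 1 \<and>
    (\<forall>s t. 0 < t \<longrightarrow> t < e \<longrightarrow> 0 < s \<longrightarrow> s < t ^ N \<longrightarrow> sgn (poly (poly P [:s:]) t) = \<sigma>)"
proof (cases "P = 0")
  case True
  then show ?thesis by (intro exI[of _ 0] exI[of _ 1]) auto
next
  case False
  obtain k P1 where P: "P = [:0, 1:] ^ k * P1" "poly P1 0 \<noteq> 0" using poly_split_zero[OF False] .
  obtain r Q where P1: "P1 = pCons r Q" by (cases P1)
  have "r \<noteq> 0" using P(2) P1 by simp
  then obtain m r1 where r: "r = [:0, 1:] ^ m * r1" "poly r1 0 \<noteq> 0" using poly_split_zero by metis
  define c where "c = poly r1 0"
  have c: "c \<noteq> 0" using r(2) by (simp add: c_def)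
  obtain C where C: "C \<ge> 0" "\<And>s t. 0 \<le> s \<Longrightarrow> s \<le> 1 \<Longrightarrow> 0 \<le> t \<Longrightarrow> t \<le> 1 \<Longrightarrow> \<bar>poly (poly Q [:s:]) t\<bar> \<le> C"
    using poly_poly_bounded[of Q] by blast
  have "1 * poly ([:- (\<bar>c\<bar> / 2):] + smult (sgn c) r1) 0 > 0"
    using c by (simp add: c_def[symmetric] sgn_if)
  then obtain e where e: "e > 0" "\<And>x. \<bar>x - 0\<bar> < e \<Longrightarrow> 1 * poly ([:- (\<bar>c\<bar> / 2):] + smult (sgn c) r1) x > 0"
    using poly_locally_pos by blast
  \<comment> \<open>The last bound yields \<open>t * C < \<bar>c\<bar> / 2\<close>, while
    \<open>e\<close> guarantees that \<open>sgn c\<close> times \<open>r1\<close> exceeds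
    \<open>\<bar>c\<bar> / 2\<close>.\<close>
  define e' where "e' = min (min e 1) (\<bar>c\<bar> / (2 * (C + 1)))"
  have e': "e' > 0" "e' \<le> 1" "e' \<le> e" "e' \<le> \<bar>c\<bar> / (2 * (C + 1))" using e(1) c C(1) by (auto simp: e'_def)
  have "sgn (poly (poly P [:s:]) t) = sgn c" if st: "0 < t" "t < e'" "0 < s" "s < t ^ Suc m" for s t
  proof -
    define B where "B = poly (poly Q [:s:]) t"
    have s1: "s \<le> 1" using st e' power_le_one[of t "Suc m"] by linarith
    have B: "\<bar>B\<bar> \<le> C" unfolding B_def by (rule C(2)) (use st e' s1 in auto)
    have val: "poly (poly P [:s:]) t = s ^ k * (t ^ m * poly r1 t + s * B)"
      by (simp add: P(1) P1 r(1) B_def poly_power algebra_simps)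
    have r1: "sgn c * poly r1 t > \<bar>c\<bar> / 2" using e(2)[of t] st e' by simp
    have "t * (2 * (C + 1)) < \<bar>c\<bar>" using st(2) e'(4) C(1) by (simp add: pos_le_divide_eq less_le_trans flip: pos_less_divide_eq)
    then have tC: "t * C < \<bar>c\<bar> / 2" using st(1) by (simp add: algebra_simps)
    have "\<bar>s * B\<bar> \<le> s * C" using B st by (simp add: abs_mult)
    also have "\<dots> \<le> t ^ Suc m * C" using st C(1) by (intro mult_right_mono) auto
    also have "\<dots> = t ^ m * (t * C)" by simp
    also have "\<dots> < t ^ m * (sgn c * poly r1 t)" using st tC r1 by (intro mult_strict_left_mono) auto
    finally have "\<bar>s * B\<bar> < sgn c * (t ^ m * poly r1 t)" by (simp add: algebra_simps)
    moreover have "\<bar>sgn c * (s * B)\<bar> = \<bar>s * B\<bar>" using c by (simp add: abs_mult)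
    ultimately have "sgn c * (t ^ m * poly r1 t + s * B) > 0" unfolding distrib_left by linarith
    then have "sgn (t ^ m * poly r1 t + s * B) = sgn c"
      using c by (auto simp: sgn_if split: if_splits)
    then show ?thesis using st(3) by (simp add: val sgn_mult)
  qed
  then show ?thesis using e'(1,2) by blast
qed

lemma polyfun_sgn_cusp:
  assumes "finite G" "G \<subseteq> polyfun {a, b}"
  shows "\<exists>N e. e > 0 \<and> e \<le> 1 \<and> (\<forall>x y.
    0 < x b \<longrightarrow> x b < e \<longrightarrow> 0 < x a \<longrightarrow> x a < x b ^ N \<longrightarrow>
    0 < y b \<longrightarrow> y b < e \<longrightarrow> 0 < y a \<longrightarrow> y a < y b ^ N \<longrightarrow> sgn_eq_on G x y)"
  using assms
proof (induction G rule: finite_induct)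
  case empty
  show ?case by (intro exI[of _ 0] exI[of _ 1]) auto
next
  case (insert g G)
  then obtain N e where e: "e > 0" "e \<le> 1" and
    Ne: "\<And>x y. 0 < x b \<Longrightarrow> x b < e \<Longrightarrow> 0 < x a \<Longrightarrow> x a < x b ^ N \<Longrightarrow>
      0 < y b \<Longrightarrow> y b < e \<Longrightarrow> 0 < y a \<Longrightarrow> y a < y b ^ N \<Longrightarrow> sgn_eq_on G x y" by blast
  obtain P where P: "\<And>x. g x = poly (poly P [:x a:]) (x b)" using polyfun_two_vars insert.prems by blast
  obtain N' e' \<sigma> where e': "e' > 0" "e' \<le> 1" and
    Ne': "\<And>s t. 0 < t \<Longrightarrow> t < e' \<Longrightarrow> 0 < s \<Longrightarrow> s < t ^ N' \<Longrightarrow> sgn (poly (poly P [:s:]) t) = \<sigma>"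
    using poly_poly_sgn_cusp[of P] by blast
  have le: "t ^ max N N' \<le> t ^ N" "t ^ max N N' \<le> t ^ N'" if "0 < t" "t < min e e'" for t :: real
    using that e by (auto intro!: power_decreasing)
  have step: "sgn_eq_on (insert g G) x y" if "0 < x b" "x b < min e e'" "0 < x a" "x a < x b ^ max N N'"
      "0 < y b" "y b < min e e'" "0 < y a" "y a < y b ^ max N N'" for x y
  proof -
    have "sgn_eq_on G x y" by (rule Ne) (use that le[of "x b"] le[of "y b"] in auto)
    moreover have "sgn (g x) = \<sigma>" "sgn (g y) = \<sigma>"
      unfolding P using that le[of "x b"] le[of "y b"] by (auto intro!: Ne')
    ultimately show ?thesis by simp
  qed
  show ?case
  proof (rule exI[of _ "max N N'"], rule exI[of _ "min e e'"], intro conjI)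
    show "0 < min e e'" "min e e' \<le> 1" using e e' by auto
  qed (intro allI impI, rule step)
qed

text \<open>Eliminate \<open>x\<close> from \<open>f x = s\<close>, \<open>g x = t\<close>, \<open>x \<in> S\<close>.  If \<open>f x < g x ^ N\<close> with \<open>g x\<close> small, then by constancy
  of signs on the cusp \<open>0 < s < t ^ N\<close> the system is solvable for \<open>t = g x\<close> and every small \<open>s > 0\<close>,
  against the positive lower bound of \<open>f\<close> on \<open>g \<ge> t\<close>.\<close>

lemma lojasiewicz_inequality:
  assumes H: "finite H" "H \<subseteq> polyfun {..<n}"
    and inv: "\<And>x y. x \<in> S \<Longrightarrow> sgn_eq_on H x y \<Longrightarrow> y \<in> S"
    and f: "f \<in> polyfun {..<n}" and g: "g \<in> polyfun {..<n}"
    and f0: "\<And>x. x \<in> S \<Longrightarrow> 0 \<le> f x" and g0: "\<And>x. x \<in> S \<Longrightarrow> 0 \<le> g x"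
    and gB: "\<And>x. x \<in> S \<Longrightarrow> g x \<le> B"
    and pos: "\<And>e. e > 0 \<Longrightarrow> \<exists>d>0. \<forall>x\<in>S. e \<le> g x \<longrightarrow> d \<le> f x"
  shows "\<exists>N C. \<forall>x\<in>S. g x ^ N \<le> C * f x"
proof -
  \<comment> \<open>Coordinates \<open>n\<close> and \<open>Suc n\<close> are fresh variables for
    the values \<open>s\<close> of \<open>f\<close> and \<open>t\<close> of \<open>g\<close>; the
    signs of \<open>H\<close> express membership in \<open>S\<close>.\<close>
  define F where "F = H \<union> {\<lambda>x. f x - x n, \<lambda>x. g x - x (Suc n)}"
  have F: "finite F" "F \<subseteq> polyfun ({..<n} \<union> {n, Suc n})"
  proof -
    have mono: "h \<in> polyfun ({..<n} \<union> {n, Suc n})" if "h \<in> polyfun {..<n}" for h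
      by (rule polyfun_mono[OF that]) auto
    have "(\<lambda>x. f x - x n) \<in> polyfun ({..<n} \<union> {n, Suc n})"
      "(\<lambda>x. g x - x (Suc n)) \<in> polyfun ({..<n} \<union> {n, Suc n})"
      by (intro polyfun_diff mono f g polyfun.var; simp)+
    then show "F \<subseteq> polyfun ({..<n} \<union> {n, Suc n})" using mono H(2) unfolding F_def by blast
  qed (simp add: F_def H(1))
  have "{..<n} \<inter> {n, Suc n} = {}" by auto
  from eliminate_variables[OF _ this F] obtain G where G: "finite G" "G \<subseteq> polyfun {n, Suc n}"
    and GF: "\<And>x y. sgn_eq_on G x y \<Longrightarrow> \<exists>y'. (\<forall>i\<in>{n, Suc n}. y' i = y i) \<and> sgn_eq_on F x y'" by auto
  obtain N e where e: "e > 0" "e \<le> 1" and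
    Ne: "\<And>x y. 0 < x (Suc n) \<Longrightarrow> x (Suc n) < e \<Longrightarrow> 0 < x n \<Longrightarrow> x n < x (Suc n) ^ N \<Longrightarrow>
      0 < y (Suc n) \<Longrightarrow> y (Suc n) < e \<Longrightarrow> 0 < y n \<Longrightarrow> y n < y (Suc n) ^ N \<Longrightarrow> sgn_eq_on G x y"
    using polyfun_sgn_cusp[OF G] by blast
  have near: "g x ^ N \<le> f x" if x: "x \<in> S" "0 < g x" "g x < e" for x
  proof (rule ccontr)
    assume "\<not> g x ^ N \<le> f x"
    then have lt: "f x < g x ^ N" by simp
    obtain d where d: "d > 0" "\<And>z. z \<in> S \<Longrightarrow> g x \<le> g z \<Longrightarrow> d \<le> f z" using pos[OF x(2)] by blast
    have fx: "f x > 0" using d(2)[OF x(1)] d(1) by simp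
    define X where "X = x(n := f x, Suc n := g x)"
    \<comment> \<open>Not above \<open>f x\<close>, so that \<open>Y\<close> is in the same cusp as
      \<open>X\<close>; below \<open>d\<close>, so that \<open>s\<close> cannot be a value of
      \<open>f\<close> where \<open>g\<close> equals \<open>g x\<close>.\<close>
    define s where "s = min (d / 2) (f x)"
    define Y where "Y = x(n := s, Suc n := g x)"
    have s: "0 < s" "s < d" "s \<le> f x" using d(1) fx by (auto simp: s_def)
    have "sgn_eq_on G X Y" by (rule Ne) (use x fx lt s in \<open>auto simp: X_def Y_def\<close>)
    from GF[OF this] obtain y where y: "y n = s" "y (Suc n) = g x" "sgn_eq_on F X y" by (auto simp: Y_def)
    have fX: "h X = h x" if "h \<in> polyfun {..<n}" for h
      by (rule polyfun_cong[OF that]) (auto simp: X_def)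
    have "sgn_eq_on H x y"
    proof
      fix h assume h: "h \<in> H"
      then have "sgn (h X) = sgn (h y)" using y(3) by (simp add: F_def)
      then show "sgn (h x) = sgn (h y)" using fX[OF subsetD[OF H(2) h]] by simp
    qed
    then have yS: "y \<in> S" using inv x(1) by blast
    have "sgn (f X - X n) = sgn (f y - y n)" "sgn (g X - X (Suc n)) = sgn (g y - y (Suc n))"
      using y(3) by (auto simp: F_def)
    then have "f y = s" "g y = g x" using fX[OF f] fX[OF g] y(1,2)
      by (simp_all add: X_def sgn_eq_0_iff)
    then show False using d(2)[OF yS] s(2) by simp
  qed
  obtain d where d: "d > 0" "\<And>x. x \<in> S \<Longrightarrow> e \<le> g x \<Longrightarrow> d \<le> f x" using pos[OF e(1)] by blast
  \<comment> \<open>The two arguments serve \<open>g x < e\<close> and \<open>e \<le> g x\<close>.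
    The exponent is raised to \<open>Suc N\<close> so that the left side vanishes at
    \<open>g x = 0\<close> even if \<open>N = 0\<close>.\<close>
  define C where "C = max 1 (max 0 B ^ Suc N / d)"
  have "g x ^ Suc N \<le> C * f x" if x: "x \<in> S" for x
  proof -
    consider "g x = 0" | "0 < g x" "g x < e" | "e \<le> g x" using g0[OF x] by linarith
    then show ?thesis
    proof cases
      case 1
      then show ?thesis using f0[OF x] by (simp add: C_def)
    next
      case 2
      have "g x ^ Suc N \<le> g x ^ N" using 2 e by (intro power_decreasing) auto
      also have "\<dots> \<le> 1 * f x" using near[OF x 2] by simp
      also have "\<dots> \<le> C * f x" using f0[OF x] by (intro mult_right_mono) (auto simp: C_def)
      finally show ?thesis .
    next
      case 3
      have "g x ^ Suc N \<le> max 0 B ^ Suc N" using g0[OF x] gB[OF x] by (intro power_mono) auto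
      also have "\<dots> = (max 0 B ^ Suc N / d) * d" using d(1) by simp
      also have "\<dots> \<le> C * d" using d(1) by (intro mult_right_mono) (auto simp: C_def)
      also have "\<dots> \<le> C * f x" using d(2)[OF x 3] by (intro mult_left_mono) (auto simp: C_def)
      finally show ?thesis .
    qed
  qed
  then show ?thesis by blast
qed

section \<open>Compact semialgebraic sets\<close>

lemma mpoly_eval_polyfun:
  assumes "mpoly_in_vars n p"
  shows "mpoly_eval p \<in> polyfun {..<n}"
  unfolding mpoly_eval_def[abs_def]
proof (intro polyfun_sum polyfun.mult polyfun.const polyfun_prod polyfun_power polyfun.var)
  fix m i assume "m \<in> Poly_Mapping.keys p" "i \<in> Poly_Mapping.keys m"
  then show "i \<in> {..<n}" using assms unfolding mpoly_in_vars_def by blast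
qed

text \<open>This is all that is used of the notion: membership is decided by finitely many
  signs.\<close>

lemma semialgebraic_sign_invariant:
  assumes "semialgebraic n E"
  shows "E \<subseteq> topspace (Euclidean_space n) \<and>
    (\<exists>H. finite H \<and> H \<subseteq> polyfun {..<n} \<and>
      (\<forall>x\<in>E. \<forall>y\<in>topspace (Euclidean_space n). sgn_eq_on H x y \<longrightarrow> y \<in> E))"
  using assms
proof (induction rule: semialgebraic.induct)
  case (eq p)
  show ?case
    by (intro conjI exI[of _ "{mpoly_eval p}"])
      (use mpoly_eval_polyfun[OF eq] in \<open>auto simp: sgn_eq_0_iff\<close>)
next
  case (gt p)
  show ?case
    by (intro conjI exI[of _ "{mpoly_eval p}"])
      (use mpoly_eval_polyfun[OF gt] in \<open>auto simp: sgn_1_pos\<close>)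
next
  case (Un A B)
  then obtain H H' where "finite H" "H \<subseteq> polyfun {..<n}"
      "\<forall>x\<in>A. \<forall>y\<in>topspace (Euclidean_space n). sgn_eq_on H x y \<longrightarrow> y \<in> A"
      "finite H'" "H' \<subseteq> polyfun {..<n}"
      "\<forall>x\<in>B. \<forall>y\<in>topspace (Euclidean_space n). sgn_eq_on H' x y \<longrightarrow> y \<in> B" by blast
  note H = this
  show ?case
  proof (intro conjI exI[of _ "H \<union> H'"] ballI impI)
    fix x y assume x: "x \<in> A \<union> B" and y: "y \<in> topspace (Euclidean_space n)" and xy0: "sgn_eq_on (H \<union> H') x y"
    note xy = xy0[unfolded ball_Un]
    have "y \<in> A" if "x \<in> A" by (rule H(3)[THEN bspec, OF that, THEN bspec, OF y, THEN mp, OF conjunct1[OF xy]])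
    moreover have "y \<in> B" if "x \<in> B" by (rule H(6)[THEN bspec, OF that, THEN bspec, OF y, THEN mp, OF conjunct2[OF xy]])
    ultimately show "y \<in> A \<union> B" using x by blast
  qed (use Un.IH H in blast)+
next
  case (Int A B)
  then obtain H H' where "finite H" "H \<subseteq> polyfun {..<n}"
      "\<forall>x\<in>A. \<forall>y\<in>topspace (Euclidean_space n). sgn_eq_on H x y \<longrightarrow> y \<in> A"
      "finite H'" "H' \<subseteq> polyfun {..<n}"
      "\<forall>x\<in>B. \<forall>y\<in>topspace (Euclidean_space n). sgn_eq_on H' x y \<longrightarrow> y \<in> B" by blast
  note H = this
  show ?case
  proof (intro conjI exI[of _ "H \<union> H'"] ballI impI)
    fix x y assume x: "x \<in> A \<inter> B" and y: "y \<in> topspace (Euclidean_space n)" and xy0: "sgn_eq_on (H \<union> H') x y"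
    note xy = xy0[unfolded ball_Un]
    have "y \<in> A" if "x \<in> A" by (rule H(3)[THEN bspec, OF that, THEN bspec, OF y, THEN mp, OF conjunct1[OF xy]])
    moreover have "y \<in> B" if "x \<in> B" by (rule H(6)[THEN bspec, OF that, THEN bspec, OF y, THEN mp, OF conjunct2[OF xy]])
    ultimately show "y \<in> A \<inter> B" using x by blast
  qed (use Int.IH H in blast)+
qed

lemma polyfun_continuous:
  assumes "f \<in> polyfun V"
  shows "continuous_on A f"
proof -
  have "continuous_on UNIV f"
    using assms by (induction rule: polyfun.induct) (auto intro!: continuous_intros)
  then show ?thesis by (rule continuous_on_subset) simp
qed

lemma compactin_Euclidean_space_imp_compact:
  assumes "compactin (Euclidean_space n) E"
  shows "compact E"
  using assms by (simp add: Euclidean_space_def compactin_subtopology euclidean_product_topology)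

lemma proj_first_in_Euclidean_space: "proj_first n x \<in> topspace (Euclidean_space n)"
  by (simp add: topspace_Euclidean_space proj_first_def)

lemma proj_first_id: "x \<in> topspace (Euclidean_space n) \<Longrightarrow> proj_first n x = x"
  by (auto simp: topspace_Euclidean_space proj_first_def fun_eq_iff)

lemma polyfun_proj_first: "f \<in> polyfun {..<n} \<Longrightarrow> f (proj_first n x) = f x"
  by (erule polyfun_cong) (simp add: proj_first_def)

lemma polyfun_bounded_on_compact:
  assumes "compact E" "finite A" "A \<subseteq> polyfun V"
  shows "\<exists>M\<ge>1. \<forall>f\<in>A. \<forall>x\<in>E. \<bar>f x\<bar> \<le> M"
  using assms(2,3)
proof (induction A rule: finite_induct)
  case empty
  show ?case by (rule exI[of _ 1]) simp
next
  case (insert f A)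
  then obtain M where M: "M \<ge> 1" "\<forall>f\<in>A. \<forall>x\<in>E. \<bar>f x\<bar> \<le> M" by auto
  have "f \<in> polyfun V" using insert.prems by simp
  then have "compact (f ` E)" by (intro compact_continuous_image polyfun_continuous assms(1))
  then have "bounded (f ` E)" by (rule compact_imp_bounded)
  then obtain B where "\<forall>x\<in>E. \<bar>f x\<bar> \<le> B" unfolding bounded_iff by auto
  then show ?case using M by (intro exI[of _ "max M B"]) fastforce
qed

text \<open>On the part of \<open>E\<close> where no nonzero sign of \<open>y0\<close> is reversed, the sum \<open>f\<close> of squares of the functions
  vanishing at \<open>y0\<close> can only vanish where the product \<open>g\<close> of the others does, so \<open>g ^ N \<le> C * f\<close> there;
  this inequality fails at \<open>y0\<close>.\<close>

lemma separate_sign_class: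
  assumes E: "compact E" "E \<subseteq> topspace (Euclidean_space n)"
    and H: "finite H" "H \<subseteq> polyfun {..<n}"
    and inv: "\<And>x y. x \<in> E \<Longrightarrow> y \<in> topspace (Euclidean_space n) \<Longrightarrow> sgn_eq_on H x y \<Longrightarrow> y \<in> E"
    and y0: "y0 \<in> topspace (Euclidean_space n)" "y0 \<notin> E"
  shows "\<exists>D. finite D \<and> D \<subseteq> polyfun {..<n} \<and> (\<forall>x\<in>E. \<exists>d\<in>D. 0 \<le> d x) \<and>
    (\<forall>y. sgn_eq_on H y0 y \<longrightarrow> (\<forall>d\<in>D. d y < 0))"
proof -
  define Q where "Q = {h\<in>H. h y0 \<noteq> 0}"
  define s where "s h = sgn (h y0)" for h :: "(nat \<Rightarrow> real) \<Rightarrow> real"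
  define f where "f x = (\<Sum>h\<in>H - Q. (h x)\<^sup>2)" for x
  define g where "g x = (\<Prod>h\<in>Q. s h * h x)" for x
  \<comment> \<open>A cylinder over a part of \<open>E\<close>: the signs do not see the coordinates
    from \<open>n\<close> on, which are zero in \<open>E\<close> but arbitrary in the Lojasiewicz
    inequality.\<close>
  define S where "S = {x. proj_first n x \<in> E \<and> (\<forall>h\<in>Q. 0 \<le> s h * h x)}"
  have Q: "finite Q" "Q \<subseteq> H" using H(1) by (auto simp: Q_def)
  have hP: "h \<in> polyfun {..<n}" if "h \<in> H" for h using that H(2) by blast
  have fP: "f \<in> polyfun {..<n}" unfolding f_def[abs_def] using hP by (intro polyfun_intros) auto
  have gP: "g \<in> polyfun {..<n}" unfolding g_def[abs_def] using hP Q by (intro polyfun_prod polyfun.mult polyfun.const) auto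
  have hproj: "h (proj_first n x) = h x" if "h \<in> H" for h x using polyfun_proj_first[OF hP[OF that]] .
  have f0: "0 \<le> f x" for x unfolding f_def by (intro sum_nonneg) auto
  have g0: "0 \<le> g x" if "x \<in> S" for x using that unfolding g_def S_def by (intro prod_nonneg) auto
  have sgn_pos: "s h * h y > 0" if "h \<in> Q" "sgn (h y0) = sgn (h y)" for h y
    using that by (auto simp: Q_def s_def sgn_if split: if_splits)
  obtain M where M: "\<And>x. x \<in> E \<Longrightarrow> \<bar>g x\<bar> \<le> M"
    using polyfun_bounded_on_compact[OF E(1), of "{g}" "{..<n}"] gP by auto
  have "\<exists>N C. \<forall>x\<in>S. g x ^ N \<le> C * f x"
  proof (rule lojasiewicz_inequality[OF H _ fP gP f0 g0])
    fix x y assume x: "x \<in> S" and xy: "sgn_eq_on H x y"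
    have pxy: "sgn_eq_on H (proj_first n x) (proj_first n y)" using xy by (simp add: hproj)
    have "proj_first n y \<in> E"
      by (rule inv[OF _ proj_first_in_Euclidean_space pxy]) (use x in \<open>simp add: S_def\<close>)
    moreover have "0 \<le> s h * h y" if h: "h \<in> Q" for h
    proof -
      have "sgn (h x) = sgn (h y)" "0 \<le> s h * h x" using xy x h Q by (auto simp: S_def)
      moreover from this have "sgn (s h * h x) = sgn (s h * h y)" by (simp add: sgn_mult)
      ultimately show ?thesis unfolding sgn_real_cases by linarith
    qed
    ultimately show "y \<in> S" by (simp add: S_def)
  next
    show "g x \<le> M" if "x \<in> S" for x
      using M[of "proj_first n x"] that polyfun_proj_first[OF gP] by (simp add: S_def)
  next
    fix e :: real assume e: "e > 0"
    define T where "T = E \<inter> (\<Inter>h\<in>Q. {x. 0 \<le> s h * h x}) \<inter> {x. e \<le> g x}"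
    have "closed ((\<Inter>h\<in>Q. {x. 0 \<le> s h * h x}) \<inter> {x. e \<le> g x})"
      by (intro closed_Int closed_INT ballI closed_Collect_le continuous_on_const continuous_on_mult
          polyfun_continuous[OF gP] polyfun_continuous[OF hP]) (use Q in auto)
    then have T: "compact T" unfolding T_def Int_assoc by (rule compact_Int_closed[OF E(1)])
    have ST: "proj_first n x \<in> T" if "x \<in> S" "e \<le> g x" for x
    proof -
      have "0 \<le> s h * h (proj_first n x)" if "h \<in> Q" for h
        using that \<open>x \<in> S\<close> hproj[OF subsetD[OF Q(2) that]] by (simp add: S_def)
      then show ?thesis using that polyfun_proj_first[OF gP, of x] by (simp add: T_def S_def)
    qed
    show "\<exists>d>0. \<forall>x\<in>S. e \<le> g x \<longrightarrow> d \<le> f x"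
    proof (cases "T = {}")
      case True
      have "\<not> e \<le> g x" if "x \<in> S" for x
      proof
        assume "e \<le> g x"
        then show False using ST[OF that] True by simp
      qed
      then show ?thesis by (intro exI[of _ 1]) auto
    next
      case False
      from continuous_attains_inf[OF T False polyfun_continuous[OF fP]]
      obtain x0 where x0: "x0 \<in> T" "\<And>x. x \<in> T \<Longrightarrow> f x0 \<le> f x" by blast
      \<comment> \<open>A zero of \<open>f\<close> in \<open>T\<close> has \<open>g > 0\<close>,
        hence exactly the signs of \<open>y0\<close>, which would put \<open>y0\<close> into
        \<open>E\<close>.\<close>
      have "f x0 \<noteq> 0"
      proof
        assume z: "f x0 = 0"
        have "\<forall>h\<in>H - Q. (h x0)\<^sup>2 = 0"
          using z H(1) unfolding f_def by (subst (asm) sum_nonneg_eq_0_iff) auto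
        moreover have "s h * h x0 > 0" if h: "h \<in> Q" for h
        proof -
          have "g x0 \<noteq> 0" using x0(1) e by (auto simp: T_def)
          then have "s h * h x0 \<noteq> 0" using h Q(1) unfolding g_def by (subst (asm) prod_zero_iff) auto
          moreover have "0 \<le> s h * h x0" using x0(1) h by (auto simp: T_def)
          ultimately show ?thesis by linarith
        qed
        ultimately have *: "h \<in> H \<Longrightarrow> h \<notin> Q \<Longrightarrow> h x0 = 0" "h \<in> Q \<Longrightarrow> s h * h x0 > 0" for h by auto
        have "sgn_eq_on H x0 y0"
        proof
          fix h assume h: "h \<in> H"
          show "sgn (h x0) = sgn (h y0)"
          proof (cases "h \<in> Q")
            case True
            from *(2)[OF this] show ?thesis by (auto simp: s_def sgn_if split: if_splits)
          next
            case False
            then show ?thesis using *(1)[OF h] h by (auto simp: Q_def)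
          qed
        qed
        then have "y0 \<in> E" by (rule inv[rotated 2]) (use x0(1) y0 in \<open>auto simp: T_def\<close>)
        then show False using y0 by simp
      qed
      then have "f x0 > 0" using f0[of x0] by simp
      moreover have "f x0 \<le> f x" if "x \<in> S" "e \<le> g x" for x
      proof -
        from x0(2)[OF ST[OF that]] show ?thesis using polyfun_proj_first[OF fP] by simp
      qed
      ultimately show ?thesis by blast
    qed
  qed
  then obtain N C where NC: "\<And>x. x \<in> S \<Longrightarrow> g x ^ N \<le> C * f x" by blast
  \<comment> \<open>The first function is nonnegative on \<open>S\<close>, and the others cover the
    points of \<open>E\<close> outside \<open>S\<close>. On the sign class of \<open>y0\<close>,
    where \<open>f = 0\<close> and \<open>g > 0\<close>, all are negative.\<close>
  define D where "D = insert (\<lambda>x. C * f x - g x ^ N) ((\<lambda>h x. - (s h * h x)) ` Q)"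
  have D1: "finite D" using Q by (simp add: D_def)
  have D2: "D \<subseteq> polyfun {..<n}"
    unfolding D_def using Q hP
    by (auto intro!: polyfun_diff polyfun_uminus polyfun.mult polyfun.const polyfun_power fP gP)
  have D3: "\<exists>d\<in>D. 0 \<le> d x" if x: "x \<in> E" for x
  proof (cases "\<forall>h\<in>Q. 0 \<le> s h * h x")
    case True
    then have "x \<in> S" using x E(2) proj_first_id[of x n] by (auto simp: S_def)
    from NC[OF this] show ?thesis by (intro bexI[of _ "\<lambda>x. C * f x - g x ^ N"]) (auto simp: D_def)
  next
    case False
    then obtain h where "h \<in> Q" "s h * h x < 0" by (auto simp: not_le)
    then show ?thesis by (intro bexI[of _ "\<lambda>x. - (s h * h x)"]) (auto simp: D_def)
  qed
  have D4: "d y < 0" if y: "sgn_eq_on H y0 y" and d: "d \<in> D" for y d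
  proof -
    have pos: "s h * h y > 0" if "h \<in> Q" for h by (rule sgn_pos[OF that]) (use that y Q in auto)
    have "h y = 0" if "h \<in> H - Q" for h
    proof -
      have "sgn (h y0) = sgn (h y)" "h y0 = 0" using that y by (auto simp: Q_def)
      then show ?thesis by (simp add: sgn_eq_0_iff)
    qed
    then have "f y = 0" unfolding f_def by (intro sum.neutral) auto
    moreover have "g y > 0" unfolding g_def using pos by (intro prod_pos) auto
    ultimately show ?thesis using d pos by (auto simp: D_def)
  qed
  show ?thesis
  proof (intro exI[of _ D] conjI D1 D2)
    show "\<forall>x\<in>E. \<exists>d\<in>D. 0 \<le> d x" using D3 by (rule ballI)
    show "\<forall>y. sgn_eq_on H y0 y \<longrightarrow> (\<forall>d\<in>D. d y < 0)"
      by (intro allI impI ballI) (rule D4)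
  qed
qed

text \<open>The compact case of the finiteness theorem: strict inequalities are not needed to describe \<open>E\<close>.\<close>

lemma compact_semialgebraic_closed_form:
  assumes E: "compactin (Euclidean_space n) E" "semialgebraic n E"
  shows "\<exists>(m::nat) D. (\<forall>k<m. finite (D k) \<and> D k \<subseteq> polyfun {..<n}) \<and>
    E = {x \<in> topspace (Euclidean_space n). \<forall>k<m. \<exists>d\<in>D k. 0 \<le> d x}"
proof -
  let ?X = "topspace (Euclidean_space n)"
  obtain H where EX: "E \<subseteq> ?X" and H: "finite H" "H \<subseteq> polyfun {..<n}"
    and inv: "\<And>x y. x \<in> E \<Longrightarrow> y \<in> ?X \<Longrightarrow> sgn_eq_on H x y \<Longrightarrow> y \<in> E"
    using semialgebraic_sign_invariant[OF E(2)] by blast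
  \<comment> \<open>Restriction to \<open>H\<close> makes sign vectors elements of a finite function
    space, so only finitely many occur off \<open>E\<close>.\<close>
  define \<sigma> where "\<sigma> y = restrict (\<lambda>h. sgn (h y)) H" for y :: "nat \<Rightarrow> real"
  have sig: "sgn_eq_on H x y \<longleftrightarrow> \<sigma> x = \<sigma> y" for x y
    by (auto simp: \<sigma>_def restrict_def fun_eq_iff)
  define \<Sigma> where "\<Sigma> = \<sigma> ` (?X - E)"
  have "\<sigma> y \<in> H \<rightarrow>\<^sub>E {-1, 0, 1}" for y
    unfolding \<sigma>_def restrict_PiE_iff by (simp add: sgn_if)
  then have "\<Sigma> \<subseteq> H \<rightarrow>\<^sub>E {-1, 0, 1}" unfolding \<Sigma>_def by blast
  then have "finite \<Sigma>" by (rule finite_subset) (intro finite_PiE H(1), simp)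
  have "\<forall>v. \<exists>D. v \<in> \<Sigma> \<longrightarrow> finite D \<and> D \<subseteq> polyfun {..<n} \<and> (\<forall>x\<in>E. \<exists>d\<in>D. 0 \<le> d x) \<and>
    (\<forall>y. \<sigma> y = v \<longrightarrow> (\<forall>d\<in>D. d y < 0))"
  proof
    fix v
    show "\<exists>D. v \<in> \<Sigma> \<longrightarrow> finite D \<and> D \<subseteq> polyfun {..<n} \<and> (\<forall>x\<in>E. \<exists>d\<in>D. 0 \<le> d x) \<and>
      (\<forall>y. \<sigma> y = v \<longrightarrow> (\<forall>d\<in>D. d y < 0))"
    proof (cases "v \<in> \<Sigma>")
      case True
      then obtain y0 where y0: "y0 \<in> ?X" "y0 \<notin> E" "v = \<sigma> y0" by (auto simp: \<Sigma>_def)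
      have "\<exists>D. finite D \<and> D \<subseteq> polyfun {..<n} \<and> (\<forall>x\<in>E. \<exists>d\<in>D. 0 \<le> d x) \<and>
          (\<forall>y. sgn_eq_on H y0 y \<longrightarrow> (\<forall>d\<in>D. d y < 0))"
        by (rule separate_sign_class[OF compactin_Euclidean_space_imp_compact[OF E(1)] EX H _ y0(1,2)])
          (rule inv)
      then obtain D where D: "finite D" "D \<subseteq> polyfun {..<n}" "\<forall>x\<in>E. \<exists>d\<in>D. 0 \<le> d x"
          "\<And>y d. \<sigma> y0 = \<sigma> y \<Longrightarrow> d \<in> D \<Longrightarrow> d y < 0" unfolding sig by blast
      show ?thesis
        by (intro exI[of _ D] impI conjI D(1-3) allI ballI D(4)) (simp_all add: y0(3))
    qed simp
  qed
  then obtain D where "\<forall>v. v \<in> \<Sigma> \<longrightarrow> finite (D v) \<and> D v \<subseteq> polyfun {..<n} \<and> (\<forall>x\<in>E. \<exists>d\<in>D v. 0 \<le> d x) \<and>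
    (\<forall>y. \<sigma> y = v \<longrightarrow> (\<forall>d\<in>D v. d y < 0))"
    unfolding choice_iff by blast
  then have D: "finite (D v)" "D v \<subseteq> polyfun {..<n}" "x \<in> E \<Longrightarrow> \<exists>d\<in>D v. 0 \<le> d x"
    "\<sigma> y = v \<Longrightarrow> d \<in> D v \<Longrightarrow> d y < 0" if "v \<in> \<Sigma>" for v x y d
    using that by blast+
  obtain b where b: "bij_betw b {0..<card \<Sigma>} \<Sigma>" using ex_bij_betw_nat_finite[OF \<open>finite \<Sigma>\<close>] by blast
  have bS: "b k \<in> \<Sigma>" if "k < card \<Sigma>" for k using b that by (auto simp: bij_betw_def)
  have "E = {x \<in> ?X. \<forall>k<card \<Sigma>. \<exists>d\<in>D (b k). 0 \<le> d x}"
  proof (intro equalityI subsetI)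
    fix x assume "x \<in> E"
    then show "x \<in> {x \<in> ?X. \<forall>k<card \<Sigma>. \<exists>d\<in>D (b k). 0 \<le> d x}" using EX D(3)[OF bS] by auto
  next
    fix x assume x: "x \<in> {x \<in> ?X. \<forall>k<card \<Sigma>. \<exists>d\<in>D (b k). 0 \<le> d x}"
    show "x \<in> E"
    proof (rule ccontr)
      assume "x \<notin> E"
      then have v: "\<sigma> x \<in> \<Sigma>" using x by (auto simp: \<Sigma>_def)
      then obtain k where k: "k < card \<Sigma>" "b k = \<sigma> x"
        using b by (metis atLeastLessThan_iff bij_betw_def imageE)
      then obtain d where "d \<in> D (\<sigma> x)" "0 \<le> d x" using x by fastforce
      then show False using D(4)[OF v refl] by force
    qed
  qed
  then show ?thesis using D(1,2)[OF bS] by (intro exI[of _ "card \<Sigma>"] exI[of _ "\<lambda>k. D (b k)"]) simp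
qed

lemma polyfun_affine_subst:
  assumes "f \<in> polyfun V"
  shows "(\<lambda>x. f (\<lambda>i. c + d * x i)) \<in> polyfun V"
  using assms by (induction rule: polyfun.induct) (auto intro!: polyfun.intros)

text \<open>A disjunction of inequalities \<open>d \<ge> 0\<close> becomes solvability in \<open>z\<close> of \<open>\<Prod>(d - z\<^sup>2) = 0\<close>.\<close>

lemma compact_semialgebraic_projection:
  assumes E: "compactin (Euclidean_space n) E" "semialgebraic n E"
  obtains K \<Psi> M where "K \<ge> n" "\<Psi> \<in> polyfun {..<K}" "\<And>q. 0 \<le> \<Psi> q"
    "E = {\<lambda>i. if i < n then - M + 2 * M * q i else 0 | q. (\<forall>i<K. 0 \<le> q i \<and> q i \<le> 1) \<and> \<Psi> q = 0}"
proof -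
  let ?X = "topspace (Euclidean_space n)"
  from compact_semialgebraic_closed_form[OF E] obtain m :: nat and D
    where D': "\<forall>k<m. finite (D k) \<and> D k \<subseteq> polyfun {..<n}"
      and Eq: "E = {x \<in> ?X. \<forall>k<m. \<exists>d\<in>D k. 0 \<le> d x}"
    by (elim exE conjE)
  have D: "finite (D k)" "D k \<subseteq> polyfun {..<n}" if "k < m" for k
    using D' that by auto
  \<comment> \<open>Coordinate \<open>n + k\<close> is the slack variable of condition
    \<open>k\<close>; the sum of squares expresses the conjunction.\<close>
  define \<Phi> where "\<Phi> w = (\<Sum>k<m. (\<Prod>d\<in>D k. d w - (w (n + k))\<^sup>2)\<^sup>2)" for w :: "nat \<Rightarrow> real"
  have \<Phi>P: "\<Phi> \<in> polyfun {..<n + m}"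
    unfolding \<Phi>_def[abs_def]
  proof (intro polyfun_sum polyfun_power polyfun_prod polyfun_diff polyfun.var)
    show "d \<in> polyfun {..<n + m}" if "k \<in> {..<m}" "d \<in> D k" for k d
      using polyfun_mono[of d "{..<n}"] D(2)[of k] that by auto
  qed auto
  have \<Phi>0: "\<Phi> w = 0 \<longleftrightarrow> (\<forall>k<m. \<exists>d\<in>D k. d w = (w (n + k))\<^sup>2)" for w
    unfolding \<Phi>_def using D(1) by (subst sum_nonneg_eq_0_iff) auto
  \<comment> \<open>The bound \<open>M\<close> on the coordinates puts \<open>E\<close> into a cube.
    The bound on each \<open>d\<close> does the same for the slack \<open>sqrt (d x)\<close>,
    because \<open>M \<ge> 1\<close> gives \<open>d x \<le> M \<le> M\<^sup>2\<close>.\<close>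
  define A where "A = (\<lambda>i x. x i) ` {..<n} \<union> (\<Union>k<m. D k)"
  have "finite A" "A \<subseteq> polyfun {..<n}" using D by (auto simp: A_def intro: polyfun.var)
  from polyfun_bounded_on_compact[OF compactin_Euclidean_space_imp_compact[OF E(1)] this]
  obtain M where M: "M \<ge> 1" "\<And>f x. f \<in> A \<Longrightarrow> x \<in> E \<Longrightarrow> \<bar>f x\<bar> \<le> M" by blast
  define \<Psi> where "\<Psi> q = \<Phi> (\<lambda>i. - M + 2 * M * q i)" for q
  show thesis
  proof (rule that[of "n + m" \<Psi> M])
    show "\<Psi> \<in> polyfun {..<n + m}" unfolding \<Psi>_def[abs_def] by (rule polyfun_affine_subst[OF \<Phi>P])
    show "0 \<le> \<Psi> q" for q by (simp add: \<Psi>_def \<Phi>_def sum_nonneg)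
    show "E = {\<lambda>i. if i < n then - M + 2 * M * q i else 0 | q. (\<forall>i<n + m. 0 \<le> q i \<and> q i \<le> 1) \<and> \<Psi> q = 0}" (is "E = ?R")
    proof (intro equalityI subsetI)
      fix x assume x: "x \<in> E"
      then have "\<forall>k. \<exists>d. k < m \<longrightarrow> d \<in> D k \<and> 0 \<le> d x" using Eq by auto
      then obtain d where d: "\<And>k. k < m \<Longrightarrow> d k \<in> D k \<and> 0 \<le> d k x" unfolding choice_iff by auto
      define w where "w i = (if i < n then x i else if i < n + m then sqrt (d (i - n) x) else 0)" for i
      define q where "q i = (w i + M) / (2 * M)" for i
      have qw: "- M + 2 * M * q i = w i" for i using M(1) by (simp add: q_def field_simps)
      have wM: "\<bar>w i\<bar> \<le> M" for i
      proof -
        consider "i < n" | "n \<le> i" "i < n + m" | "i \<ge> n + m" by linarith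
        then show ?thesis
        proof cases
          case 1
          then show ?thesis using M(2)[of "\<lambda>x. x i" x] x by (auto simp: w_def A_def)
        next
          case 2
          then have k: "i - n < m" by linarith
          have "d (i - n) \<in> A" using d[OF k] k by (auto simp: A_def)
          then have "d (i - n) x \<le> M" using M(2)[OF _ x] by force
          also have "M \<le> M\<^sup>2" using M(1) by (simp add: power2_eq_square)
          finally have "sqrt (d (i - n) x) \<le> M" using M(1) by (intro real_le_lsqrt) (use d[OF k] in auto)
          then show ?thesis using 2 d[OF k] by (simp add: w_def)
        next
          case 3
          then show ?thesis using M(1) by (simp add: w_def)
        qed
      qed
      have "0 \<le> q i \<and> q i \<le> 1" for i using wM[of i] M(1) by (auto simp: q_def field_simps)
      moreover have "\<Psi> q = 0"
      proof -
        have "d k w = (w (n + k))\<^sup>2" if "k < m" for k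
        proof -
          have "d k w = d k x"
            by (rule polyfun_cong[of "d k" "{..<n}"]) (use d[OF that] D(2)[OF that] in \<open>auto simp: w_def\<close>)
          then show ?thesis using that d[OF that] by (simp add: w_def)
        qed
        then show ?thesis unfolding \<Psi>_def qw \<Phi>0 using d by blast
      qed
      moreover have "x = (\<lambda>i. if i < n then - M + 2 * M * q i else 0)"
        using x Eq unfolding qw by (auto simp: w_def topspace_Euclidean_space fun_eq_iff)
      ultimately show "x \<in> ?R" by blast
    next
      fix x assume "x \<in> ?R"
      then obtain q where q: "x = (\<lambda>i. if i < n then - M + 2 * M * q i else 0)" "\<Psi> q = 0" by blast
      define w where "w i = - M + 2 * M * q i" for i
      have xw: "x = proj_first n w" by (auto simp: q(1) w_def proj_first_def)
      have "\<Phi> w = 0" using q(2) by (simp add: \<Psi>_def w_def[abs_def])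
      then have *: "\<exists>d\<in>D k. d w = (w (n + k))\<^sup>2" if "k < m" for k using that unfolding \<Phi>0 by blast
      have "\<exists>d\<in>D k. 0 \<le> d x" if k: "k < m" for k
      proof -
        obtain d where "d \<in> D k" "d w = (w (n + k))\<^sup>2" using *[OF k] by blast
        moreover have "d x = d w" unfolding xw
          by (rule polyfun_proj_first) (use D(2)[OF k] \<open>d \<in> D k\<close> in blast)
        ultimately show ?thesis by (intro bexI[of _ d]) auto
      qed
      then show "x \<in> E" unfolding Eq using proj_first_in_Euclidean_space[of n w] by (simp add: xw)
    qed
  qed simp
qed

section \<open>The game\<close>

definition multiaffine :: "((nat \<Rightarrow> real) \<Rightarrow> real) \<Rightarrow> bool" where
  "multiaffine U \<longleftrightarrow> (\<forall>p i t. U (p(i := t)) = (1 - t) * U (p(i := 0)) + t * U (p(i := 1)))"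

definition depends_on :: "((nat \<Rightarrow> real) \<Rightarrow> real) \<Rightarrow> nat set \<Rightarrow> bool" where
  "depends_on U I \<longleftrightarrow> (\<forall>p q. (\<forall>i\<in>I. p i = q i) \<longrightarrow> U p = U q)"

lemma depends_onD: "depends_on U I \<Longrightarrow> (\<And>i. i \<in> I \<Longrightarrow> p i = q i) \<Longrightarrow> U p = U q"
  unfolding depends_on_def by blast

lemma depends_on_upd: "depends_on U I \<Longrightarrow> i \<notin> I \<Longrightarrow> U (p(i := t)) = U p"
  by (erule depends_onD) auto

lemma depends_on_mono: "depends_on U I \<Longrightarrow> I \<subseteq> J \<Longrightarrow> depends_on U J"
  unfolding depends_on_def by blast

lemma multiaffine_const: "multiaffine (\<lambda>p. c)"
  by (simp add: multiaffine_def algebra_simps)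

lemma multiaffine_coord: "multiaffine (\<lambda>p. p j)"
  by (simp add: multiaffine_def algebra_simps)

lemma multiaffine_add: "multiaffine U \<Longrightarrow> multiaffine W \<Longrightarrow> multiaffine (\<lambda>p. U p + W p)"
  unfolding multiaffine_def by (simp add: algebra_simps)

lemma multiaffineD: "multiaffine U \<Longrightarrow> U (p(i := t)) = (1 - t) * U (p(i := 0)) + t * U (p(i := 1))"
  unfolding multiaffine_def by blast

lemma multiaffine_cmult:
  assumes "multiaffine U"
  shows "multiaffine (\<lambda>p. c * U p)"
  unfolding multiaffine_def
proof (intro allI)
  fix p :: "nat \<Rightarrow> real" and i t
  show "c * U (p(i := t)) = (1 - t) * (c * U (p(i := 0))) + t * (c * U (p(i := 1)))"
    unfolding multiaffineD[OF assms, of p i t] by (simp add: algebra_simps)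
qed

lemma multiaffine_diff: "multiaffine U \<Longrightarrow> multiaffine W \<Longrightarrow> multiaffine (\<lambda>p. U p - W p)"
  using multiaffine_add[OF _ multiaffine_cmult[of W "-1"], of U] by simp

text \<open>Each coordinate enters at most one factor, so the other factor is a constant for
  it.\<close>

lemma multiaffine_mult:
  assumes "multiaffine U" "multiaffine W" "depends_on U I" "depends_on W J" "I \<inter> J = {}"
  shows "multiaffine (\<lambda>p. U p * W p)"
  unfolding multiaffine_def
proof (intro allI)
  fix p :: "nat \<Rightarrow> real" and i t
  let ?g = "\<lambda>p. U p * W p"
  show "?g (p(i := t)) = (1 - t) * ?g (p(i := 0)) + t * ?g (p(i := 1))"
  proof (cases "i \<in> I")
    case True
    then have "i \<notin> J" using assms(5) by auto
    then have W: "W (p(i := x)) = W p" for x by (rule depends_on_upd[OF assms(4)])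
    then show ?thesis
      unfolding W multiaffineD[OF assms(1), of p i t] by (simp add: algebra_simps)
  next
    case False
    then have U: "U (p(i := x)) = U p" for x by (rule depends_on_upd[OF assms(3)])
    then show ?thesis
      unfolding U multiaffineD[OF assms(2), of p i t] by (simp add: algebra_simps)
  qed
qed

text \<open>Repeated factors are replaced by distinct copies: coordinate \<open>i\<close> of the multiaffine function
  stands for the variable \<open>i mod K\<close>.\<close>

lemma polyfun_polarize:
  assumes "f \<in> polyfun {..<K}" "K \<ge> 1"
  shows "\<exists>b U. a \<le> b \<and> multiaffine U \<and> depends_on U {a..<b} \<and>
    (\<forall>p q. (\<forall>i\<in>{a..<b}. p i = q (i mod K)) \<longrightarrow> U p = f q)"
  using assms(1)
proof (induction arbitrary: a rule: polyfun.induct)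
  case (const c)
  show ?case by (rule exI[of _ a], rule exI[of _ "\<lambda>p. c"]) (simp add: multiaffine_const depends_on_def)
next
  case (var i)
  \<comment> \<open>\<open>K * a + i\<close> is an index that is at least \<open>a\<close> and has
    residue \<open>i\<close> modulo \<open>K\<close>.\<close>
  have "a \<le> K * a + i" using assms(2) by (intro trans_le_add1) simp
  then have "K * a + i \<in> {a..<K * a + K}" "(K * a + i) mod K = i" using var by auto
  then show ?case
    by (intro exI[of _ "K * a + K"] exI[of _ "\<lambda>p. p (K * a + i)"])
      (auto simp: multiaffine_coord depends_on_def)
next
  case (add f g)
  obtain b U where U: "a \<le> b" "multiaffine U" "depends_on U {a..<b}"
    "\<And>p q. \<forall>i\<in>{a..<b}. p i = q (i mod K) \<Longrightarrow> U p = f q" using add.IH(1)[of a] by blast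
  obtain c W where W: "b \<le> c" "multiaffine W" "depends_on W {b..<c}"
    "\<And>p q. \<forall>i\<in>{b..<c}. p i = q (i mod K) \<Longrightarrow> W p = g q" using add.IH(2)[of b] by blast
  have dep: "depends_on U {a..<c}" "depends_on W {a..<c}"
    using depends_on_mono[OF U(3)] depends_on_mono[OF W(3)] U(1) W(1) by auto
  show ?case
  proof (intro exI[of _ c] exI[of _ "\<lambda>p. U p + W p"] conjI allI impI)
    show "depends_on (\<lambda>p. U p + W p) {a..<c}" using dep unfolding depends_on_def by metis
    fix p q :: "nat \<Rightarrow> real" assume "\<forall>i\<in>{a..<c}. p i = q (i mod K)"
    then show "U p + W p = f q + g q" using U(1) U(4)[of p q] W(1) W(4)[of p q] by simp
  qed (use U W in \<open>auto intro: multiaffine_add\<close>)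
next
  case (mult f g)
  obtain b U where U: "a \<le> b" "multiaffine U" "depends_on U {a..<b}"
    "\<And>p q. \<forall>i\<in>{a..<b}. p i = q (i mod K) \<Longrightarrow> U p = f q" using mult.IH(1)[of a] by blast
  \<comment> \<open>Starting the second factor at \<open>b\<close> gives the two factors disjoint
    copies, which makes their product multiaffine.\<close>
  obtain c W where W: "b \<le> c" "multiaffine W" "depends_on W {b..<c}"
    "\<And>p q. \<forall>i\<in>{b..<c}. p i = q (i mod K) \<Longrightarrow> W p = g q" using mult.IH(2)[of b] by blast
  have dep: "depends_on U {a..<c}" "depends_on W {a..<c}"
    using depends_on_mono[OF U(3)] depends_on_mono[OF W(3)] U(1) W(1) by auto
  show ?case
  proof (intro exI[of _ c] exI[of _ "\<lambda>p. U p * W p"] conjI allI impI)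
    show "multiaffine (\<lambda>p. U p * W p)" by (rule multiaffine_mult[OF U(2) W(2) U(3) W(3)]) auto
    show "depends_on (\<lambda>p. U p * W p) {a..<c}" using dep unfolding depends_on_def by metis
    fix p q :: "nat \<Rightarrow> real" assume "\<forall>i\<in>{a..<c}. p i = q (i mod K)"
    then show "U p * W p = f q * g q" using U(1) U(4)[of p q] W(1) W(4)[of p q] by simp
  qed (use U W in auto)
qed

text \<open>Independent coordinates can be averaged one at a time, and a multiaffine function
  commutes with each averaging. The values \<open>r\<close> off \<open>A\<close> are arbitrary so
  that the induction can fix the coordinate just drawn.\<close>

lemma expectation_Pi_pmf_multiaffine:
  fixes \<sigma> :: "nat \<Rightarrow> bool pmf"
  assumes "finite A" "multiaffine U"
  shows "measure_pmf.expectation (Pi_pmf A d \<sigma>) (\<lambda>s. U (\<lambda>i. if i \<in> A then of_bool (s i) else r i)) =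
    U (\<lambda>i. if i \<in> A then pmf (\<sigma> i) True else r i)"
  using assms(1)
proof (induction A arbitrary: r rule: finite_induct)
  case empty
  show ?case by simp
next
  case (insert x A)
  define P where "P = Pi_pmf A d \<sigma>"
  define F where "F r s = U (\<lambda>i. if i \<in> A then of_bool (s i) else r i)" for r and s :: "nat \<Rightarrow> bool"
  have IH: "measure_pmf.expectation P (F r) = U (\<lambda>i. if i \<in> A then pmf (\<sigma> i) True else r i)" for r
    unfolding P_def F_def by (rule insert.IH)
  have fin: "finite (set_pmf P)"
    unfolding P_def by (rule finite_subset[OF set_Pi_pmf_subset'[OF insert.hyps(1)]])
      (auto intro!: finite_PiE_dflt insert.hyps(1))
  have upd: "(\<lambda>i. if i \<in> insert x A then of_bool ((s(x := y)) i) else r i) =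
      (\<lambda>i. if i \<in> A then of_bool (s i) else (r(x := of_bool y)) i)" for s y
    using insert.hyps(2) by auto
  define q where "q = (\<lambda>i. if i \<in> A then pmf (\<sigma> i) True else r i)"
  have q: "(\<lambda>i. if i \<in> A then pmf (\<sigma> i) True else (r(x := c)) i) = q(x := c)" for c
    using insert.hyps(2) by (auto simp: q_def)
  let ?h = "\<lambda>s. U (\<lambda>i. if i \<in> insert x A then of_bool (s i) else r i)"
  have "Pi_pmf (insert x A) d \<sigma> = \<sigma> x \<bind> (\<lambda>y. map_pmf (\<lambda>f. f(x := y)) P)"
    unfolding P_def by (subst Pi_pmf_insert'[OF insert.hyps]) (simp add: map_pmf_def)
  then have "measure_pmf.expectation (Pi_pmf (insert x A) d \<sigma>) ?h =
      (\<Sum>y\<in>UNIV. pmf (\<sigma> x) y *\<^sub>R measure_pmf.expectation (map_pmf (\<lambda>f. f(x := y)) P) ?h)"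
    by (simp only:) (rule pmf_expectation_bind, use fin in auto)
  also have "\<dots> = (\<Sum>y\<in>UNIV. pmf (\<sigma> x) y * measure_pmf.expectation P (F (r(x := of_bool y))))"
    unfolding integral_map_pmf upd F_def by simp
  also have "\<dots> = (1 - pmf (\<sigma> x) True) * U (q(x := 0)) + pmf (\<sigma> x) True * U (q(x := 1))"
    unfolding IH q by (simp add: UNIV_bool pmf_False_conv_True)
  also have "\<dots> = U (q(x := pmf (\<sigma> x) True))"
    by (rule multiaffineD[OF assms(2), symmetric])
  also have "q(x := pmf (\<sigma> x) True) = (\<lambda>i. if i \<in> insert x A then pmf (\<sigma> i) True else r i)"
    by (auto simp: q_def)
  finally show ?case .
qed

text \<open>When neither \<open>A i\<close> nor \<open>B i\<close> depends on coordinate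
  \<open>i\<close>, \<open>A i\<close> is the payoff for \<open>False\<close> and \<open>B i\<close>
  the gain from playing \<open>True\<close> instead, so the sign of \<open>B i\<close> determines
  the best replies.\<close>

definition affine_game :: "nat \<Rightarrow> (nat \<Rightarrow> (nat \<Rightarrow> real) \<Rightarrow> real) \<Rightarrow> (nat \<Rightarrow> (nat \<Rightarrow> real) \<Rightarrow> real) \<Rightarrow> binary_game" where
  "affine_game N A B = (\<lambda>i s. let p = (\<lambda>j. if j < N then of_bool (s j) else 0) in A i p + p i * B i p)"

abbreviation prob_vector :: "nat \<Rightarrow> mixed_profile \<Rightarrow> nat \<Rightarrow> real" where
  "prob_vector N \<sigma> \<equiv> \<lambda>j. if j < N then pmf (\<sigma> j) True else 0"

locale affine_binary_game =
  fixes N :: nat and A B :: "nat \<Rightarrow> (nat \<Rightarrow> real) \<Rightarrow> real"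
  assumes multiaffine_A: "i < N \<Longrightarrow> multiaffine (A i)" and multiaffine_B: "i < N \<Longrightarrow> multiaffine (B i)"
    and depends_A: "i < N \<Longrightarrow> depends_on (A i) (- {i})" and depends_B: "i < N \<Longrightarrow> depends_on (B i) (- {i})"
begin

lemma expected_payoff_eq:
  assumes "i < N"
  shows "expected_payoff N (affine_game N A B) \<sigma> i =
    A i (prob_vector N \<sigma>) + prob_vector N \<sigma> i * B i (prob_vector N \<sigma>)"
proof -
  let ?U = "\<lambda>p. A i p + p i * B i p"
  have "multiaffine (\<lambda>p. p i * B i p)"
    by (rule multiaffine_mult[OF multiaffine_coord multiaffine_B[OF assms], of i "{i}" "- {i}"])
      (use depends_B[OF assms] in \<open>auto simp: depends_on_def\<close>)
  then have "multiaffine ?U" by (intro multiaffine_add multiaffine_A assms)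
  from expectation_Pi_pmf_multiaffine[OF finite_lessThan[of N] this, of undefined \<sigma> "\<lambda>_. 0"]
  show ?thesis unfolding expected_payoff_def affine_game_def Let_def by simp
qed

lemma nash_equilibrium_iff:
  "nash_equilibrium N (affine_game N A B) \<sigma> \<longleftrightarrow>
    (\<forall>i<N. \<forall>t. 0 \<le> t \<and> t \<le> 1 \<longrightarrow>
      t * B i (prob_vector N \<sigma>) \<le> prob_vector N \<sigma> i * B i (prob_vector N \<sigma>))"
proof -
  have dev: "expected_payoff N (affine_game N A B) (\<sigma>(i := \<tau>)) i =
      A i (prob_vector N \<sigma>) + pmf \<tau> True * B i (prob_vector N \<sigma>)" if i: "i < N" for i \<tau>
  proof -
    have upd: "prob_vector N (\<sigma>(i := \<tau>)) = (prob_vector N \<sigma>)(i := pmf \<tau> True)" using i by auto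
    have "A i (p(i := t)) = A i p" "B i (p(i := t)) = B i p" for p t
      using depends_on_upd[OF depends_A[OF i], of i] depends_on_upd[OF depends_B[OF i], of i] by simp_all
    then show ?thesis using i unfolding expected_payoff_eq[OF i] upd by simp
  qed
  have "(\<forall>\<tau>. pmf \<tau> True * b \<le> c) \<longleftrightarrow> (\<forall>t. 0 \<le> t \<and> t \<le> 1 \<longrightarrow> t * b \<le> c)" for b c :: real
  proof
    assume *: "\<forall>\<tau>. pmf \<tau> True * b \<le> c"
    show "\<forall>t. 0 \<le> t \<and> t \<le> 1 \<longrightarrow> t * b \<le> c"
    proof (intro allI impI)
      fix t :: real assume "0 \<le> t \<and> t \<le> 1"
      then show "t * b \<le> c" using *[THEN spec[of _ "bernoulli_pmf t"]] by simp
    qed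
  next
    assume "\<forall>t. 0 \<le> t \<and> t \<le> 1 \<longrightarrow> t * b \<le> c"
    then show "\<forall>\<tau>. pmf \<tau> True * b \<le> c" by (simp add: pmf_le_1)
  qed
  note pmf_t = this
  have "nash_equilibrium N (affine_game N A B) \<sigma> \<longleftrightarrow>
    (\<forall>i<N. \<forall>\<tau>. pmf \<tau> True * B i (prob_vector N \<sigma>) \<le> prob_vector N \<sigma> i * B i (prob_vector N \<sigma>))"
    unfolding nash_equilibrium_def using dev expected_payoff_eq by simp
  then show ?thesis unfolding pmf_t .
qed

lemma nash_equilibrium_pure:
  assumes "nash_equilibrium N (affine_game N A B) \<sigma>" "i < N"
  shows "B i (prob_vector N \<sigma>) > 0 \<Longrightarrow> prob_vector N \<sigma> i = 1"
    "B i (prob_vector N \<sigma>) < 0 \<Longrightarrow> prob_vector N \<sigma> i = 0"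
proof -
  let ?p = "prob_vector N \<sigma>"
  have *: "t * B i ?p \<le> ?p i * B i ?p" if "0 \<le> t" "t \<le> 1" for t
    using assms that unfolding nash_equilibrium_iff by blast
  have p01: "0 \<le> ?p i" "?p i \<le> 1" by (simp_all add: pmf_le_1)
  show "?p i = 1" if pos: "B i ?p > 0"
  proof -
    have "1 * B i ?p \<le> ?p i * B i ?p" by (rule *) simp_all
    then have "1 \<le> ?p i" by (simp only: mult_le_cancel_right_pos[OF pos])
    then show ?thesis using p01 by linarith
  qed
  show "?p i = 0" if neg: "B i ?p < 0"
  proof -
    have "0 * B i ?p \<le> ?p i * B i ?p" by (rule *) simp_all
    then have "?p i \<le> 0" by (simp only: mult_le_cancel_right_neg[OF neg])
    then show ?thesis using p01 by linarith
  qed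
qed

end

text \<open>Players \<open>i < K\<close> carry the variables, players \<open>K + m\<close> with \<open>m < T\<close> copy variable \<open>m mod K\<close>, and player
  \<open>K + T + m\<close> enforces the \<open>m\<close>-th copy in a matching-pennies fashion.  The incentive of player \<open>i < K\<close> to play
  \<open>True\<close> is \<open>\<Psi> p * (w i - p i)\<close>: where \<open>\<Psi> p > 0\<close> it would force \<open>p = w\<close>, although \<open>\<Psi> w = 0\<close>.\<close>

lemma exists_binary_game:
  assumes K: "K \<ge> 1" "n \<le> K" and \<Psi>: "\<Psi> \<in> polyfun {..<K}" "\<And>q. 0 \<le> \<Psi> q"
    and w: "\<And>i. i < K \<Longrightarrow> 0 \<le> w i \<and> w i \<le> 1" "\<Psi> w = 0"
  shows "\<exists>N u. N > n \<and> proj_first n ` nash_payoffs N u =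
    {\<lambda>i. if i < n then a + b * q i else 0 | q. (\<forall>i<K. 0 \<le> q i \<and> q i \<le> 1) \<and> \<Psi> q = 0}"
proof -
  \<comment> \<open>Starting at \<open>K\<close>, the copies are players themselves: player
    \<open>j\<close> from \<open>K\<close> on stands for variable \<open>j mod K\<close>.\<close>
  have pol: "\<exists>c U. K \<le> c \<and> multiaffine U \<and> depends_on U {K..<c} \<and>
    (\<forall>p q. (\<forall>j\<in>{K..<c}. p j = q (j mod K)) \<longrightarrow> U p = \<Psi> q * (w i - q i))" if "i < K" for i
    by (rule polyfun_polarize[OF _ K(1)]) (use that in \<open>intro polyfun.mult \<Psi>(1) polyfun_diff polyfun.const polyfun.var; simp\<close>)
  then have "\<forall>i. \<exists>c U. i < K \<longrightarrow> K \<le> c \<and> multiaffine U \<and> depends_on U {K..<c} \<and>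
    (\<forall>p q. (\<forall>j\<in>{K..<c}. p j = q (j mod K)) \<longrightarrow> U p = \<Psi> q * (w i - q i))" by blast
  then obtain c U where cU: "\<forall>i. i < K \<longrightarrow> K \<le> c i \<and> multiaffine (U i) \<and> depends_on (U i) {K..<c i} \<and>
    (\<forall>p q. (\<forall>j\<in>{K..<c i}. p j = q (j mod K)) \<longrightarrow> U i p = \<Psi> q * (w i - q i))"
    unfolding choice_iff by blast
  \<comment> \<open>Enough for all copies used by the \<open>U i\<close>, and at least
    \<open>K\<close>, so that every variable has the copy \<open>K + i\<close> read by
    \<open>A\<close>.\<close>
  define T where "T = K + (\<Sum>i<K. c i)"
  have cT: "c i \<le> K + T" if "i < K" for i
    using member_le_sum[of i "{..<K}" c] that by (simp add: T_def)
  have U: "multiaffine (U i)" "depends_on (U i) {K..<K + T}"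
    "\<And>p q. \<forall>j\<in>{K..<K + T}. p j = q (j mod K) \<Longrightarrow> U i p = \<Psi> q * (w i - q i)" if i: "i < K" for i
  proof -
    show "multiaffine (U i)" using cU i by blast
    have "depends_on (U i) {K..<c i}" using cU i by blast
    then show "depends_on (U i) {K..<K + T}" by (rule depends_on_mono) (use cT[OF i] in auto)
    fix p q :: "nat \<Rightarrow> real" assume "\<forall>j\<in>{K..<K + T}. p j = q (j mod K)"
    then have "\<forall>j\<in>{K..<c i}. p j = q (j mod K)" using cT[OF i] by auto
    then show "U i p = \<Psi> q * (w i - q i)" using cU i by blast
  qed
  define N where "N = K + 2 * T"
  \<comment> \<open>The copy stands in for \<open>p i\<close>, on which \<open>A i\<close> must not
    depend.\<close>
  define A where "A i p = (if i < K then a + b * p (K + i) else 0)" for i and p :: "nat \<Rightarrow> real"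
  \<comment> \<open>A copying player follows the majority of its enforcer \<open>i + T\<close>,
    which plays \<open>True\<close> when the copy is too low and \<open>False\<close> when it is too
    high.\<close>
  define B where "B i p = (if i < K then U i p else if i < K + T then 2 * p (i + T) - 1
      else p ((i - T) mod K) - p (i - T))" for i and p :: "nat \<Rightarrow> real"
  have T: "T \<ge> K" by (simp add: T_def)
  have N: "n < N" using K T by (simp add: N_def)
  have modK: "j mod K < K" for j using K(1) by simp
  interpret affine_binary_game N A B
  proof
    fix i assume i: "i < N"
    show "multiaffine (A i)"
      unfolding A_def[abs_def] by (cases "i < K") (auto intro!: multiaffine_add multiaffine_cmult multiaffine_coord multiaffine_const)
    show "depends_on (A i) (- {i})"
      unfolding A_def[abs_def] depends_on_def using K(1) by auto
    consider "i < K" | "K \<le> i" "i < K + T" | "K + T \<le> i" by linarith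
    then have "multiaffine (B i) \<and> depends_on (B i) (- {i})"
    proof cases
      case 1
      then have "B i = U i" by (auto simp: B_def fun_eq_iff)
      then show ?thesis using U(1,2)[OF 1] depends_on_mono[OF U(2)[OF 1], of "- {i}"] 1 by auto
    next
      case 2
      then have "B i = (\<lambda>p. 2 * p (i + T) - 1)" by (auto simp: B_def fun_eq_iff)
      then show ?thesis using T K(1)
        by (auto intro!: multiaffine_diff multiaffine_cmult multiaffine_coord multiaffine_const simp: depends_on_def)
    next
      case 3
      then have "B i = (\<lambda>p. p ((i - T) mod K) - p (i - T))" by (auto simp: B_def fun_eq_iff)
      moreover have "(i - T) mod K < i" "i - T < i" using modK[of "i - T"] 3 T K(1) by linarith+
      ultimately show ?thesis
        by (auto intro!: multiaffine_diff multiaffine_coord simp: depends_on_def)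
    qed
    then show "multiaffine (B i)" "depends_on (B i) (- {i})" by blast+
  qed
  let ?u = "affine_game N A B"
  have eq1: "\<Psi> p = 0 \<and> (\<forall>i<n. expected_payoff N ?u \<sigma> i = a + b * p i)"
    if ne: "nash_equilibrium N ?u \<sigma>" and p: "p = prob_vector N \<sigma>" for \<sigma> p
  proof -
    have p01: "0 \<le> p i" "p i \<le> 1" for i by (auto simp: p pmf_le_1)
    have pure: "B i p > 0 \<Longrightarrow> p i = 1" "B i p < 0 \<Longrightarrow> p i = 0" if "i < N" for i
      using nash_equilibrium_pure[OF ne that] unfolding p by blast+
    \<comment> \<open>A copy that is too low would have its enforcer at 1 and so be at 1 itself,
      which is not too low; the other case is symmetric.\<close>
    have copy: "p j = p (j mod K)" if j: "K \<le> j" "j < K + T" for j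
    proof -
      have jN: "j < N" "j + T < N" using j by (auto simp: N_def)
      have Bj: "B j p = 2 * p (j + T) - 1" using j by (simp add: B_def)
      have BT: "B (j + T) p = p (j mod K) - p j" using j by (simp add: B_def)
      show ?thesis
      proof (rule linorder_cases[of "p j" "p (j mod K)"])
        assume lt: "p j < p (j mod K)"
        then have "p (j + T) = 1" using pure(1)[OF jN(2)] BT by simp
        then have "p j = 1" using pure(1)[OF jN(1)] Bj by simp
        then show ?thesis using lt p01(2)[of "j mod K"] by simp
      next
        assume gt: "p (j mod K) < p j"
        then have "p (j + T) = 0" using pure(2)[OF jN(2)] BT by simp
        then have "p j = 0" using pure(2)[OF jN(1)] Bj by simp
        then show ?thesis using gt p01(1)[of "j mod K"] by simp
      qed
    qed
    have Bi: "B i p = \<Psi> p * (w i - p i)" if i: "i < K" for i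
      using U(3)[OF i, of p p] copy i by (simp add: B_def)
    have "\<Psi> p = 0"
    proof (rule ccontr)
      assume "\<Psi> p \<noteq> 0"
      then have pos: "\<Psi> p > 0" using \<Psi>(2)[of p] by simp
      \<comment> \<open>A player below \<open>w i\<close> would have to be at 1 and one above it at
        0, against \<open>0 \<le> w i \<le> 1\<close>.\<close>
      have "p i = w i" if i: "i < K" for i
      proof -
        have iN: "i < N" using i by (simp add: N_def)
        show ?thesis
        proof (rule linorder_cases[of "p i" "w i"])
          assume lt: "p i < w i"
          then have "B i p > 0" unfolding Bi[OF i] using pos by simp
          then show ?thesis using pure(1)[OF iN] lt w(1)[OF i] by linarith
        next
          assume gt: "w i < p i"
          then have "B i p < 0" unfolding Bi[OF i] using pos by (intro mult_pos_neg) simp_all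
          then show ?thesis using pure(2)[OF iN] gt w(1)[OF i] by linarith
        qed
      qed
      then have "\<Psi> p = \<Psi> w" by (intro polyfun_cong[OF \<Psi>(1)]) simp
      then show False using w(2) pos by simp
    qed
    moreover have "expected_payoff N ?u \<sigma> i = a + b * p i" if i: "i < n" for i
    proof -
      have iK: "i < K" "i < N" using i K N by auto
      have "B i p = 0" using Bi[OF iK(1)] \<open>\<Psi> p = 0\<close> by simp
      moreover have "p (K + i) = p i" using copy[of "K + i"] iK T by simp
      moreover have "expected_payoff N ?u \<sigma> i = A i p + p i * B i p"
        using expected_payoff_eq[OF iK(2), of \<sigma>] unfolding p .
      ultimately show ?thesis using iK(1) by (simp add: A_def)
    qed
    ultimately show ?thesis by blast
  qed
  have eq2: "\<exists>\<sigma>. nash_equilibrium N ?u \<sigma> \<and> (\<forall>i<K. prob_vector N \<sigma> i = q i)"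
    if q: "\<forall>i<K. 0 \<le> q i \<and> q i \<le> 1" "\<Psi> q = 0" for q
  proof -
    \<comment> \<open>Exact copies and evenly mixing enforcers make every player indifferent; the
      players \<open>i < K\<close> are so because \<open>\<Psi> q = 0\<close>.\<close>
    define \<sigma> where "\<sigma> j = bernoulli_pmf (if j < K + T then q (j mod K) else 1 / 2)" for j
    define p where "p = prob_vector N \<sigma>"
    have p1: "p j = q (j mod K)" if "j < K + T" for j
      using that q(1) modK[of j] by (simp add: p_def \<sigma>_def N_def)
    have p2: "p j = 1 / 2" if "K + T \<le> j" "j < N" for j
      using that by (simp add: p_def \<sigma>_def)
    have "B i p = 0" if i: "i < N" for i
    proof -
      consider "i < K" | "K \<le> i" "i < K + T" | "K + T \<le> i" by linarith
      then show ?thesis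
      proof cases
        case 1
        then have "U i p = \<Psi> q * (w i - q i)" using p1 by (intro U(3)) auto
        then show ?thesis using q(2) 1 by (simp add: B_def)
      next
        case 2
        then have "p (i + T) = 1 / 2" by (intro p2) (auto simp: N_def)
        then show ?thesis using 2 by (simp add: B_def)
      next
        case 3
        have "i - T < K + T" using i by (simp add: N_def)
        moreover have "(i - T) mod K < K + T" using modK[of "i - T"] by simp
        ultimately show ?thesis using p1 3 by (simp add: B_def)
      qed
    qed
    then have "nash_equilibrium N ?u \<sigma>" unfolding nash_equilibrium_iff p_def[symmetric] by simp
    moreover have "p i = q i" if "i < K" for i using p1[of i] that by simp
    ultimately show ?thesis unfolding p_def by blast
  qed
  have proj: "proj_first n (\<lambda>i. if i < N then v i else 0) = (\<lambda>i. if i < n then v i else 0)" for v :: "nat \<Rightarrow> real"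
    using N by (auto simp: proj_first_def fun_eq_iff)
  have "proj_first n ` nash_payoffs N ?u =
    {\<lambda>i. if i < n then a + b * q i else 0 | q. (\<forall>i<K. 0 \<le> q i \<and> q i \<le> 1) \<and> \<Psi> q = 0}" (is "_ = ?R")
  proof (intro equalityI subsetI)
    fix x assume "x \<in> proj_first n ` nash_payoffs N ?u"
    then obtain \<sigma> where \<sigma>: "nash_equilibrium N ?u \<sigma>"
      "x = (\<lambda>i. if i < n then expected_payoff N ?u \<sigma> i else 0)"
      unfolding nash_payoffs_def by (auto simp: proj)
    define p where "p = prob_vector N \<sigma>"
    have "\<forall>i<K. 0 \<le> p i \<and> p i \<le> 1" by (simp add: p_def pmf_le_1)
    moreover have "x = (\<lambda>i. if i < n then a + b * p i else 0)"
      using eq1[OF \<sigma>(1) p_def] \<sigma>(2) by auto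
    ultimately show "x \<in> ?R" using eq1[OF \<sigma>(1) p_def] by blast
  next
    fix x assume "x \<in> ?R"
    then obtain q where q: "x = (\<lambda>i. if i < n then a + b * q i else 0)"
      "\<forall>i<K. 0 \<le> q i \<and> q i \<le> 1" "\<Psi> q = 0" by blast
    from eq2[OF q(2,3)] obtain \<sigma> where \<sigma>: "nash_equilibrium N ?u \<sigma>" "\<forall>i<K. prob_vector N \<sigma> i = q i" by blast
    define v where "v = (\<lambda>i. if i < N then expected_payoff N ?u \<sigma> i else 0)"
    have "v \<in> nash_payoffs N ?u" unfolding nash_payoffs_def v_def using \<sigma>(1) by blast
    moreover have "proj_first n v = x"
      unfolding v_def proj q(1) using conjunct2[OF eq1[OF \<sigma>(1) refl]] \<sigma>(2) K(2)
      by (auto simp: fun_eq_iff)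
    ultimately show "x \<in> proj_first n ` nash_payoffs N ?u" by blast
  qed
  then show ?thesis using N by blast
qed

theorem proposition2:
  fixes n :: nat and E :: "(nat \<Rightarrow> real) set"
  assumes "n \<ge> 1"
    and "E \<noteq> {}"
    and "compactin (Euclidean_space n) E"
    and "semialgebraic n E"
  shows "\<exists>(N::nat) (u::binary_game). N > n \<and> proj_first n ` nash_payoffs N u = E"
proof -
  obtain K \<Psi> M where K: "K \<ge> n" and \<Psi>: "\<Psi> \<in> polyfun {..<K}" "\<And>q. 0 \<le> \<Psi> q"
    and E: "E = {\<lambda>i. if i < n then - M + 2 * M * q i else 0 | q. (\<forall>i<K. 0 \<le> q i \<and> q i \<le> 1) \<and> \<Psi> q = 0}"
    by (rule compact_semialgebraic_projection[OF assms(3,4)]) (rule that; assumption)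
  \<comment> \<open>Nonemptiness of \<open>E\<close> provides the zero towards which the players are
    pulled.\<close>
  obtain w where w: "\<forall>i<K. 0 \<le> w i \<and> w i \<le> 1" "\<Psi> w = 0" using assms(2) unfolding E by blast
  have "K \<ge> 1" using K assms(1) by simp
  show ?thesis
    unfolding E by (rule exists_binary_game[OF \<open>K \<ge> 1\<close> K \<Psi> _ w(2)]) (use w(1) in blast)
qed

end
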